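(* Let $Q$ be a solution to the equivalent measure extension problem, and let $\Lambda$ be the nondecreasing predictable process in the multiplicative Doob--Meyer decomposition $Z_t=e^{-\Lambda_t}K_t$ of $Z_t=Q(\tau>t\mid\mathcal F_t)$ under $Q$. Assume $D$ is a subset of $\mathbb R^k$ for some $k$, and that the law of $X_t$ under $Q$ admits a density (with respect to Lebesgue measure) for almost every $t>0$. Let $\overline{D_0}$ be the closure in $D$ of $D_0=\pi\circ h^{-1}(\{0\})=\{x\in D:x=\pi(y)\text{ for some }y\in E\text{ with }h(y)=0\}$. Then, if $\overline{D_0}$ is a (Lebesgue) nullset in $\mathbb R^k$, the paths of $\Lambda$ are singular (i.e. $Q$-a.s. the measure $d\Lambda_t$ is singular with respect to Lebesgue measure).
   Context: Path space. $E$ is a locally compact topological space with a countable base, $E_\Delta=E\cup\{\Delta\}$ where $\Delta\notin E$ is an isolated point. $\Omega$ is the set of all right-continuous paths $\omega:\mathbb R_+\to E_\Delta$ that are absorbed at $\Delta$ (if $\omega(s)=\Delta$ then $\omega(t)=\Delta$ for all $t\ge s$) and have left limits on $(0,\zeta(\omega))$, where $\zeta(\omega)=\inf\{t\ge0:\omega(t)=\Delta\}$. $Y_t(\omega)=\omega(t)$ is the coordinate process, $\mathcal G^o_t=\sigma(Y_s:s\le t)$, $\mathcal G_t=\bigcap_{u>t}\mathcal G^o_u$, $\mathbb G=(\mathcal G_t)_{t\ge0}$, $\mathcal G=\bigvee_{t\ge0}\mathcal G_t$; $P$ is a probability on $\mathcal G$. Filtrations are not augmented with nullsets. The local martingale.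 $h:E_\Delta\to[0,\infty)$ is continuous on $E$ with $h(Y_0)=1$ $P$-a.s.; $\tau_n=n\wedge\inf\{t\ge0: h(Y_t)\le 1/n\}$, $\tau=\lim_n\tau_n$. It is assumed that $N_t=\frac{1}{h(Y_t)}\mathbf 1_{\{\tau>t\}}$ is a càdlàg, $P$-a.s. strictly positive local martingale under $P$ (so $P(\tau<\infty)=0$). Subfiltration. $D$ is a metrizable topological space with $\Delta\notin D$, $D_\Delta=D\cup\{\Delta\}$, $\pi:E\to D$ is a continuous map, extended by $\pi(\Delta)=\Delta$. $X_t=\pi(Y_t)$, and $\mathbb F=(\mathcal F_t)_{t\ge0}$ with $\mathcal F_t=\bigcap_{u>t}\sigma(X_s:s\le u)$. Föllmer measure. $Q_n$ is the probability on $\mathcal G_{\tau_n}$ with $dQ_n=N_{\tau_n}\,dP$; $Q_0$ is the probability on $\mathcal G_{\tau-}=\bigvee_n\mathcal G_{\tau_n}$ that coincides with $Q_n$ on $\mathcal G_{\tau_n-}$ for each $n$. A probability $Q$ on $(\Omega,\mathcal G)$ solves the equivalent measure extension problem if (1) $Q=Q_0$ on $\mathcal G_{\tau-}$, and (2) the restrictions of $P$ and $Q$ to $\mathcal F_t$ are equivalent for each $t\ge0$. $Z_t=Q(\tau>t\mid\mathcal F_t)$ denotes the càdlàg modification of this $(\mathbb F,Q)$-supermartingale; when $Q$ solves the equivalent measure extension problem it is strictly positive and has a unique multiplicative decomposition $Z_t=e^{-\Lambda_t}K_t$ with $\Lambda$ nondecreasing and $\mathbb F$-predictable, $\Lambda_0=0$,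 and $K$ an $(\mathbb F,Q)$-local martingale with $K_0=1$. *)

theory Defs
  imports "HOL-Probability.Probability"
begin

text \<open>The space \<open>E \<union> {\<Delta>}\<close> is the option type with \<open>\<Delta> = None\<close>. Its topology is that of
  the disjoint sum of \<open>E\<close> and \<open>{\<Delta>}\<close>.\<close>

instantiation option :: (topological_space) topological_space
begin

definition open_option :: "'a option set \<Rightarrow> bool" where
  "open_option U \<longleftrightarrow> open (Some -` U)"

instance
  by standard (auto simp: open_option_def vimage_Union)

end

text \<open>Processes are indexed by real times, of which only those \<open>\<ge> 0\<close> matter. Filtrations and
  stopping times use the index type \<^typ>\<open>ennreal\<close>; the \<open>\<sigma>\<close>-algebra at time \<open>\<top>\<close> is the one
  generated by all the others. No null sets are added anywhere.\<close>

definition natural_filtration ::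
  "'w set \<Rightarrow> (real \<Rightarrow> 'w \<Rightarrow> 'b::topological_space) \<Rightarrow> ennreal \<Rightarrow> 'w measure" where
  "natural_filtration \<Omega> X t =
     sigma \<Omega> {X s -` A \<inter> \<Omega> | s A. 0 \<le> s \<and> ennreal s \<le> t \<and> A \<in> sets borel}"

text \<open>Inserting \<open>\<top>\<close> changes nothing for finite \<open>t\<close>; at \<open>t = \<top>\<close> it keeps the intersection from
  being empty.\<close>

definition right_limit_filtration :: "(ennreal \<Rightarrow> 'w measure) \<Rightarrow> ennreal \<Rightarrow> 'w measure" where
  "right_limit_filtration F t = sigma (space (F t)) (\<Inter>u\<in>insert \<top> {t<..}. sets (F u))"

definition strict_pre_sigma :: "'w set \<Rightarrow> (ennreal \<Rightarrow> 'w measure) \<Rightarrow> ('w \<Rightarrow> ennreal) \<Rightarrow> 'w measure" where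
  "strict_pre_sigma \<Omega> F T =
     sigma \<Omega> (sets (F 0) \<union> {{\<omega>\<in>A. ennreal t < T \<omega>} | t A. 0 \<le> t \<and> A \<in> sets (F (ennreal t))})"

definition cadlag :: "(real \<Rightarrow> real) \<Rightarrow> bool" where
  "cadlag f \<longleftrightarrow> (\<forall>t\<ge>0. (f \<longlongrightarrow> f t) (at_right t)) \<and> (\<forall>t>0. \<exists>l. (f \<longlongrightarrow> l) (at_left t))"

definition adapted :: "(ennreal \<Rightarrow> 'w measure) \<Rightarrow> (real \<Rightarrow> 'w \<Rightarrow> real) \<Rightarrow> bool" where
  "adapted F X \<longleftrightarrow> (\<forall>t\<ge>0. X t \<in> borel_measurable (F (ennreal t)))"

definition martingale :: "'w measure \<Rightarrow> (ennreal \<Rightarrow> 'w measure) \<Rightarrow> (real \<Rightarrow> 'w \<Rightarrow> real) \<Rightarrow> bool" where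
  "martingale M F X \<longleftrightarrow> adapted F X \<and> (\<forall>t\<ge>0. integrable M (X t)) \<and>
     (\<forall>s t. 0 \<le> s \<longrightarrow> s \<le> t \<longrightarrow> (AE \<omega> in M. real_cond_exp M (F (ennreal s)) (X t) \<omega> = X s \<omega>))"

definition stopped :: "(real \<Rightarrow> 'w \<Rightarrow> real) \<Rightarrow> ('w \<Rightarrow> ennreal) \<Rightarrow> real \<Rightarrow> 'w \<Rightarrow> real" where
  "stopped X T t \<omega> = X (enn2real (min (ennreal t) (T \<omega>))) \<omega>"

text \<open>Since the filtrations are not augmented, path properties are only required almost surely.\<close>

definition local_martingale ::
  "'w measure \<Rightarrow> (ennreal \<Rightarrow> 'w measure) \<Rightarrow> (real \<Rightarrow> 'w \<Rightarrow> real) \<Rightarrow> bool" where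
  "local_martingale M F X \<longleftrightarrow> adapted F X \<and> (AE \<omega> in M. cadlag (\<lambda>t. X t \<omega>)) \<and>
     (\<exists>T :: nat \<Rightarrow> 'w \<Rightarrow> ennreal.
        (\<forall>n. stopping_time F (T n)) \<and>
        (AE \<omega> in M. incseq (\<lambda>n. T n \<omega>) \<and> (SUP n. T n \<omega>) = \<top>) \<and>
        (\<forall>n. martingale M F (stopped X (T n))))"

definition predictable_sigma :: "'w set \<Rightarrow> (ennreal \<Rightarrow> 'w measure) \<Rightarrow> (real \<times> 'w) measure" where
  "predictable_sigma \<Omega> F = sigma ({0..} \<times> \<Omega>)
     ({{0} \<times> A | A. A \<in> sets (F 0)} \<union>
      {{s<..t} \<times> A | s t A. 0 \<le> s \<and> s \<le> t \<and> A \<in> sets (F (ennreal s))})"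

definition predictable :: "'w set \<Rightarrow> (ennreal \<Rightarrow> 'w measure) \<Rightarrow> (real \<Rightarrow> 'w \<Rightarrow> real) \<Rightarrow> bool" where
  "predictable \<Omega> F X \<longleftrightarrow> (\<lambda>(t, \<omega>). X t \<omega>) \<in> borel_measurable (predictable_sigma \<Omega> F)"

type_synonym 'e path = "real \<Rightarrow> 'e option"

definition lifetime :: "'e path \<Rightarrow> ennreal" where
  "lifetime \<omega> = Inf {ennreal t | t. 0 \<le> t \<and> \<omega> t = None}"

text \<open>Being extensional makes an element the same thing as a function on \<open>[0,\<infinity>)\<close>. A left limit
  before the lifetime lies in \<open>E\<close> automatically, because \<^term>\<open>None\<close> is isolated.\<close>

definition path_space :: "'e::topological_space path set" where
  "path_space = {\<omega> \<in> extensional {0..}.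
     (\<forall>s\<ge>0. \<omega> s = None \<longrightarrow> (\<forall>t\<ge>s. \<omega> t = None)) \<and>
     (\<forall>t\<ge>0. (\<omega> \<longlongrightarrow> \<omega> t) (at_right t)) \<and>
     (\<forall>t>0. ennreal t < lifetime \<omega> \<longrightarrow> (\<exists>l. (\<omega> \<longlongrightarrow> l) (at_left t)))}"

definition G_filtration :: "ennreal \<Rightarrow> 'e::topological_space path measure" where
  "G_filtration = right_limit_filtration (natural_filtration path_space (\<lambda>t \<omega>. \<omega> t))"

definition G_total :: "'e::topological_space path measure" where
  "G_total = G_filtration \<top>"

definition observed :: "('e \<Rightarrow> 'd) \<Rightarrow> real \<Rightarrow> 'e path \<Rightarrow> 'd option" where
  "observed \<pi> t \<omega> = map_option \<pi> (\<omega> t)"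

definition F_filtration ::
  "('e::topological_space \<Rightarrow> 'd::topological_space) \<Rightarrow> ennreal \<Rightarrow> 'e path measure" where
  "F_filtration \<pi> = right_limit_filtration (natural_filtration path_space (observed \<pi>))"

definition tau_n :: "('e option \<Rightarrow> real) \<Rightarrow> nat \<Rightarrow> 'e path \<Rightarrow> ennreal" where
  "tau_n h n \<omega> = min (of_nat n) (Inf {ennreal t | t. 0 \<le> t \<and> h (\<omega> t) \<le> 1 / real n})"

text \<open>The sequence is nondecreasing in \<open>n\<close> (with value 0 at \<open>n = 0\<close>), so its limit is its supremum.\<close>

definition tau :: "('e option \<Rightarrow> real) \<Rightarrow> 'e path \<Rightarrow> ennreal" where
  "tau h \<omega> = (SUP n. tau_n h n \<omega>)"

definition N_process :: "('e option \<Rightarrow> real) \<Rightarrow> real \<Rightarrow> 'e path \<Rightarrow> real" where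
  "N_process h t \<omega> = 1 / h (\<omega> t) * indicator {\<omega>. ennreal t < tau h \<omega>} \<omega>"

text \<open>The set \<open>{h \<le> 1/n}\<close> is closed rather than open, so on a path space with jumps its entry
  time need not be measurable for the unaugmented filtration. It is almost surely equal to a
  stopping time of that filtration, and such versions stand in for \<^const>\<open>tau_n\<close> wherever a
  \<open>\<sigma>\<close>-algebra at \<^const>\<open>tau_n\<close> is formed. If \<^const>\<open>tau_n\<close> is itself a stopping time it is one
  of its own versions.\<close>

definition tau_versions ::
  "'e::topological_space path measure \<Rightarrow> ('e option \<Rightarrow> real) \<Rightarrow> (nat \<Rightarrow> 'e path \<Rightarrow> ennreal) \<Rightarrow> bool" where
  "tau_versions P h T \<longleftrightarrow>
     (\<forall>n\<ge>1. stopping_time G_filtration (T n) \<and> (AE \<omega> in P. T n \<omega> = tau_n h n \<omega>))"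

definition G_stopped :: "('e::topological_space path \<Rightarrow> ennreal) \<Rightarrow> 'e path measure" where
  "G_stopped T = filtration.pre_sigma path_space G_filtration T"

definition G_tau_minus :: "(nat \<Rightarrow> 'e::topological_space path \<Rightarrow> ennreal) \<Rightarrow> 'e path measure" where
  "G_tau_minus T = sigma path_space (\<Union>n\<in>{1..}. sets (G_stopped (T n)))"

definition Q_local :: "'e::topological_space path measure \<Rightarrow> ('e option \<Rightarrow> real) \<Rightarrow>
    ('e path \<Rightarrow> ennreal) \<Rightarrow> 'e path measure" where
  "Q_local P h T = density (restr_to_subalg P (G_stopped T))
     (\<lambda>\<omega>. ennreal (N_process h (enn2real (T \<omega>)) \<omega>))"

definition foellmer_measure :: "'e::topological_space path measure \<Rightarrow> ('e option \<Rightarrow> real) \<Rightarrow>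
    (nat \<Rightarrow> 'e path \<Rightarrow> ennreal) \<Rightarrow> 'e path measure \<Rightarrow> bool" where
  "foellmer_measure P h T Q0 \<longleftrightarrow>
     prob_space Q0 \<and> sets Q0 = sets (G_tau_minus T) \<and>
     (\<forall>n\<ge>1. \<forall>A\<in>sets (strict_pre_sigma path_space G_filtration (T n)).
        emeasure Q0 A = emeasure (Q_local P h (T n)) A)"

definition equivalent_measure_extension :: "'e::topological_space path measure \<Rightarrow>
    ('e option \<Rightarrow> real) \<Rightarrow> ('e \<Rightarrow> 'd::topological_space) \<Rightarrow> 'e path measure \<Rightarrow> bool" where
  "equivalent_measure_extension P h \<pi> Q \<longleftrightarrow>
     prob_space Q \<and> sets Q = sets G_total \<and>
     (\<exists>T Q0. tau_versions P h T \<and> foellmer_measure P h T Q0 \<and>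
        (\<forall>A\<in>sets (G_tau_minus T). emeasure Q A = emeasure Q0 A)) \<and>
     (\<forall>t\<ge>0.
        absolutely_continuous (restr_to_subalg P (F_filtration \<pi> (ennreal t)))
          (restr_to_subalg Q (F_filtration \<pi> (ennreal t))) \<and>
        absolutely_continuous (restr_to_subalg Q (F_filtration \<pi> (ennreal t)))
          (restr_to_subalg P (F_filtration \<pi> (ennreal t))))"

definition survival_process :: "('e option \<Rightarrow> real) \<Rightarrow> ('e::topological_space \<Rightarrow> 'd::topological_space) \<Rightarrow>
    'e path measure \<Rightarrow> (real \<Rightarrow> 'e path \<Rightarrow> real) \<Rightarrow> bool" where
  "survival_process h \<pi> Q Z \<longleftrightarrow>
     adapted (F_filtration \<pi>) Z \<and> (AE \<omega> in Q. cadlag (\<lambda>t. Z t \<omega>)) \<and>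
     (\<forall>t\<ge>0. AE \<omega> in Q.
        Z t \<omega> = real_cond_exp Q (F_filtration \<pi> (ennreal t)) (indicator {\<omega>. ennreal t < tau h \<omega>}) \<omega>)"

definition multiplicative_decomposition :: "'w measure \<Rightarrow> (ennreal \<Rightarrow> 'w measure) \<Rightarrow>
    (real \<Rightarrow> 'w \<Rightarrow> real) \<Rightarrow> (real \<Rightarrow> 'w \<Rightarrow> real) \<Rightarrow> (real \<Rightarrow> 'w \<Rightarrow> real) \<Rightarrow> bool" where
  "multiplicative_decomposition M F Z \<Lambda> K \<longleftrightarrow>
     predictable (space M) F \<Lambda> \<and>
     (AE \<omega> in M. \<Lambda> 0 \<omega> = 0 \<and> mono_on {0..} (\<lambda>t. \<Lambda> t \<omega>) \<and>
        (\<forall>t\<ge>0. ((\<lambda>s. \<Lambda> s \<omega>) \<longlongrightarrow> \<Lambda> t \<omega>) (at_right t))) \<and>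
     local_martingale M F K \<and> (AE \<omega> in M. K 0 \<omega> = 1) \<and>
     (AE \<omega> in M. \<forall>t\<ge>0. Z t \<omega> = exp (- \<Lambda> t \<omega>) * K t \<omega>)"

definition mutually_singular :: "'a measure \<Rightarrow> 'a measure \<Rightarrow> bool" where
  "mutually_singular M N \<longleftrightarrow> sets M = sets N \<and>
     (\<exists>S\<in>sets M. emeasure M S = 0 \<and> emeasure N (space N - S) = 0)"

text \<open>The measure \<open>df\<close> on \<open>(0,\<infinity>)\<close>, viewed as a measure on the real line.\<close>

definition stieltjes_measure :: "(real \<Rightarrow> real) \<Rightarrow> real measure" where
  "stieltjes_measure f = interval_measure (\<lambda>t. f (max 0 t))"

text \<open>Lebesgue measure on \<open>\<real>\<^sup>k \<union> {\<Delta>}\<close>, giving no mass to \<open>\<Delta>\<close>.\<close>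

definition lborel_option :: "'d::euclidean_space option measure" where
  "lborel_option = distr lborel borel Some"

end

theory Submission
  imports Defs
begin

text \<open>
  The idea is that \<open>\<Lambda>\<close> stands still as long as \<open>X = \<pi>(Y)\<close> keeps a positive distance from
  \<open>D\<^sub>0 = \<pi>(h = 0)\<close>, while the times at which \<open>X\<close> lies in the closure of \<open>D\<^sub>0\<close> form a Lebesgue null
  set.

  Why \<open>X\<close> must come close to \<open>D\<^sub>0\<close> before \<open>\<tau>\<close>: on events strictly before \<open>\<tau>\<^sub>n\<close> the measure \<open>Q\<close>
  has density \<open>N\<close> at \<open>\<tau>\<^sub>n\<close> with respect to \<open>P\<close>, and these densities all have total mass 1. Since
  \<open>\<tau>\<^sub>m\<close> tends to infinity under \<open>P\<close>, the mass on which \<open>\<tau>\<^sub>m\<close> has not yet passed \<open>\<tau>\<^sub>n\<close> vanishes as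
  \<open>m\<close> grows. Hence \<open>\<tau>\<^sub>n < \<tau>\<close> for all \<open>n\<close> \<open>Q\<close>-almost surely: \<open>h(Y)\<close> gets arbitrarily small before
  \<open>\<tau>\<close> and does not jump to 0 (\<open>witness_before_tau\<close>). Under \<open>Q\<close> the path never reaches \<open>\<Delta>\<close>, because
  \<open>X\<close> has densities on \<open>\<real>\<^sup>k\<close>. So the left limit \<open>y\<close> of \<open>Y\<close> at \<open>\<tau>\<close> exists, it satisfies
  \<open>h(y) = 0\<close>, and \<open>X\<close> approaches \<open>\<pi>(y) \<in> D\<^sub>0\<close> (\<open>close_before_tau\<close>).

  Why \<open>\<Lambda>\<close> stands still: fix \<open>s < t\<close> and let \<open>\<rho>\<close> be the first time in \<open>[s,t]\<close> at which \<open>X\<close> is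
  close to \<open>D\<^sub>0\<close>, or \<open>t\<close> if there is none. By the previous paragraph \<open>\<tau>\<close> does not lie in
  \<open>(s,\<rho>]\<close>, so \<open>E[Z\<^sub>\<rho>] = Q(\<tau> > \<rho>) = Q(\<tau> > s) = E[Z\<^sub>s]\<close>. Put \<open>W = exp(-\<Lambda>\<^sub>s)\<close>. The nonnegative local
  martingale \<open>K\<close> is a supermartingale, so \<open>E[K\<^sub>\<rho> W] \<le> E[K\<^sub>s W] = E[Z\<^sub>s]\<close>. On the other hand
  \<open>K\<^sub>\<rho> W = exp(\<Lambda>\<^sub>\<rho> - \<Lambda>\<^sub>s) Z\<^sub>\<rho> \<ge> Z\<^sub>\<rho>\<close>. All these inequalities are therefore equalities, and since
  \<open>Z > 0\<close>, which is where the equivalence of \<open>P\<close> and \<open>Q\<close> enters, \<open>\<Lambda>\<^sub>\<rho> = \<Lambda>\<^sub>s\<close>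
  (\<open>flat_off_hits\<close>). The time \<open>\<rho>\<close> is approximated by first hitting times of finite sets of rational
  times; for these, optional stopping is a finite sum over a partition of \<open>\<Omega>\<close>.

  Conclusion: outside one null set of paths, \<open>d\<Lambda>\<close> gives no mass to any interval with rational ends on
  which \<open>X\<close> stays away from \<open>D\<^sub>0\<close>. By right continuity these intervals cover all but countably many
  of the times at which \<open>X\<close> is not in the closure of \<open>D\<^sub>0\<close>, and by Fubini almost every time is such
  a time (\<open>mutually_singular_if_flat_where_positive\<close>,
  \<open>observed_off_closure_at_almost_every_time\<close>).
\<close>

section \<open>Paths, the added point and the filtrations\<close>

lemma continuous_on_optionI:
  fixes f :: "'a::topological_space option \<Rightarrow> 'b::topological_space"
  assumes "continuous_on UNIV (\<lambda>x. f (Some x))"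
  shows "continuous_on UNIV f"
proof (subst continuous_on_open_vimage, simp, intro allI impI)
  fix B :: "'b set" assume "open B"
  then have "open ((\<lambda>x. f (Some x)) -` B)"
    using assms by (simp add: continuous_on_open_vimage)
  then show "open (f -` B \<inter> UNIV)"
    by (simp add: open_option_def vimage_def)
qed

lemma continuous_on_map_option:
  fixes f :: "'a::topological_space \<Rightarrow> 'b::topological_space"
  assumes "continuous_on UNIV f"
  shows "continuous_on UNIV (map_option f)"
proof (rule continuous_on_optionI, subst continuous_on_open_vimage, simp, intro allI impI)
  fix B :: "'b option set" assume "open B"
  then have "open (f -` (Some -` B))"
    using assms by (simp add: open_option_def continuous_on_open_vimage)
  then show "open ((\<lambda>x. map_option f (Some x)) -` B \<inter> UNIV)"
    by (simp add: vimage_def)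
qed

lemma path_right_continuous:
  fixes f :: "'e::topological_space option \<Rightarrow> 'b::topological_space"
  assumes "continuous_on UNIV f" "\<omega> \<in> path_space" "0 \<le> t"
  shows "((\<lambda>s. f (\<omega> s)) \<longlongrightarrow> f (\<omega> t)) (at_right t)"
proof -
  have "(\<omega> \<longlongrightarrow> \<omega> t) (at_right t)"
    using assms by (auto simp: path_space_def)
  then show ?thesis
    by (rule continuous_on_tendsto_compose[OF assms(1)]) auto
qed

text \<open>Paths are observed at rational times, so that conditions on a path are countable intersections of
  events; right continuity recovers the other times.\<close>

lemma eventually_at_right_rational:
  fixes t b :: real
  assumes "eventually R (at_right t)" "t < b"
  obtains q where "q \<in> \<rat>" "t < q" "q < b" "R q"
proof -
  obtain c where "c > t" "\<And>y. t < y \<Longrightarrow> y < c \<Longrightarrow> R y"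
    using assms(1) by (auto simp: eventually_at_right_field)
  moreover obtain q where "q \<in> \<rat>" "t < q" "q < min b c"
    using Rats_dense_in_real[of t "min b c"] \<open>t < b\<close> \<open>t < c\<close> by auto
  ultimately show ?thesis using that[of q] by auto
qed

lemma right_continuous_ge_if_rational:
  fixes f :: "real \<Rightarrow> real"
  assumes f: "(f \<longlongrightarrow> f t) (at_right t)" and "t < b"
    and ge: "\<And>q. q \<in> \<rat> \<Longrightarrow> t < q \<Longrightarrow> q < b \<Longrightarrow> c \<le> f q"
  shows "c \<le> f t"
proof (rule ccontr)
  assume "\<not> c \<le> f t"
  then have "eventually (\<lambda>s. f s < c) (at_right t)"
    using order_tendstoD(2)[OF f] by auto
  from eventually_at_right_rational[OF this \<open>t < b\<close>] ge show False
    by (metis not_le)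
qed

lemma space_natural_filtration [simp]: "space (natural_filtration \<Omega> X t) = \<Omega>"
  unfolding natural_filtration_def by (rule space_measure_of) auto

lemma natural_filtration_generators:
  "sets (natural_filtration \<Omega> X t)
    = sigma_sets \<Omega> {X s -` A \<inter> \<Omega> | s A. 0 \<le> s \<and> ennreal s \<le> t \<and> A \<in> sets borel}"
  unfolding natural_filtration_def by (rule sets_measure_of) auto

lemma natural_filtration_mono:
  "s \<le> t \<Longrightarrow> sets (natural_filtration \<Omega> X s) \<subseteq> sets (natural_filtration \<Omega> X t)"
  unfolding natural_filtration_generators
  by (rule sigma_sets_mono') (auto intro: order_trans)

lemma measurable_natural_filtration:
  assumes "0 \<le> s" "ennreal s \<le> t"
  shows "X s \<in> measurable (natural_filtration \<Omega> X t) borel"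
proof (rule measurableI)
  fix A :: "'b set" assume "A \<in> sets borel"
  then show "X s -` A \<inter> space (natural_filtration \<Omega> X t) \<in> sets (natural_filtration \<Omega> X t)"
    unfolding natural_filtration_generators using assms by (auto intro!: sigma_sets.Basic)
qed auto

context
  fixes F :: "ennreal \<Rightarrow> 'w measure" and \<Omega> :: "'w set"
  assumes F: "filtration \<Omega> F"
begin

text \<open>The intersection is already a \<open>\<sigma>\<close>-algebra, so generating one from it adds no sets.\<close>

lemma sets_right_limit_filtration:
  "sets (right_limit_filtration F t) = (\<Inter>u\<in>insert \<top> {t<..}. sets (F u))"
proof -
  have "sigma_sets \<Omega> (\<Inter>u\<in>insert \<top> {t<..}. sets (F u)) \<subseteq> sets (F v)" if "v \<in> insert \<top> {t<..}" for v
    using that by (intro sets.sigma_sets_subset[of _ "F v", unfolded filtration.space_F[OF F]]) auto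
  moreover have "(\<Inter>u\<in>insert \<top> {t<..}. sets (F u)) \<subseteq> Pow \<Omega>"
    using sets.space_closed[of "F \<top>"] filtration.space_F[OF F] by auto
  ultimately show ?thesis
    unfolding right_limit_filtration_def filtration.space_F[OF F]
    by (subst sets_measure_of) (auto intro!: sigma_sets.Basic)
qed

lemma filtration_right_limit: "filtration \<Omega> (right_limit_filtration F)"
proof
  show "space (right_limit_filtration F i) = \<Omega>" for i
    unfolding right_limit_filtration_def filtration.space_F[OF F]
    by (rule space_measure_of)
      (use sets.space_closed[of "F \<top>"] filtration.space_F[OF F] in auto)
  show "sets (right_limit_filtration F i) \<le> sets (right_limit_filtration F j)" if "i \<le> j" for i j
    unfolding sets_right_limit_filtration by (intro INF_superset_mono) (use that in auto)
qed

lemma sets_le_right_limit_filtration: "sets (F t) \<subseteq> sets (right_limit_filtration F t)"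
  unfolding sets_right_limit_filtration
  by (intro INF_greatest filtration.sets_F_mono[OF F]) auto

end

lemma filtration_natural: "filtration \<Omega> (natural_filtration \<Omega> X)"
  by standard (simp_all add: natural_filtration_mono)

lemma filtration_G: "filtration path_space G_filtration"
  unfolding G_filtration_def by (intro filtration_right_limit filtration_natural)

lemma filtration_F: "filtration path_space (F_filtration \<pi>)"
  unfolding F_filtration_def by (intro filtration_right_limit filtration_natural)

lemma measurable_right_limit_natural:
  assumes "0 \<le> s" "ennreal s \<le> t"
  shows "X s \<in> measurable (right_limit_filtration (natural_filtration \<Omega> X) t) borel"
  using measurable_natural_filtration[OF assms, of X \<Omega>]
    sets_le_right_limit_filtration[OF filtration_natural, of \<Omega> X t]
    filtration.space_F[OF filtration_right_limit[OF filtration_natural], of \<Omega> X t]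
  by (auto simp: measurable_def subset_iff)

lemma measurable_coordinate:
  assumes "0 \<le> s" "ennreal s \<le> t"
  shows "(\<lambda>\<omega>. \<omega> s) \<in> measurable (G_filtration t) borel"
  using measurable_right_limit_natural[OF assms, of "\<lambda>s \<omega>. \<omega> s"] by (simp add: G_filtration_def)

lemma measurable_observed:
  assumes "0 \<le> s" "ennreal s \<le> t"
  shows "observed \<pi> s \<in> measurable (F_filtration \<pi> t) borel"
  unfolding F_filtration_def by (rule measurable_right_limit_natural[OF assms])

lemma F_filtration_le_G_filtration:
  fixes \<pi> :: "'e::topological_space \<Rightarrow> 'd::topological_space"
  assumes \<pi>: "continuous_on UNIV \<pi>"
  shows "sets (F_filtration \<pi> t) \<subseteq> sets (G_filtration t)"
proof -
  have "sets (natural_filtration path_space (observed \<pi>) u)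
      \<subseteq> sets (natural_filtration path_space (\<lambda>t \<omega>. \<omega> t) u)" for u
  proof (subst natural_filtration_generators,
      rule sets.sigma_sets_subset[of _ "natural_filtration path_space (\<lambda>t \<omega>. \<omega> t) u", simplified],
      safe)
    fix s and A :: "'d option set" assume s: "0 \<le> s" "ennreal s \<le> u" and A: "A \<in> sets borel"
    have "map_option \<pi> \<in> borel \<rightarrow>\<^sub>M borel"
      using continuous_on_map_option[OF \<pi>] by (rule borel_measurable_continuous_onI)
    with measurable_natural_filtration[OF s, of "\<lambda>t \<omega>. \<omega> t" path_space]
    have "(\<lambda>\<omega>. map_option \<pi> (\<omega> s)) \<in> natural_filtration path_space (\<lambda>t \<omega>. \<omega> t) u \<rightarrow>\<^sub>M borel"
      by (rule measurable_compose)
    from measurable_sets[OF this A]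
    show "observed \<pi> s -` A \<inter> path_space \<in> sets (natural_filtration path_space (\<lambda>t \<omega>. \<omega> t) u)"
      by (simp add: observed_def[abs_def])
  qed
  then show ?thesis
    unfolding F_filtration_def G_filtration_def
      sets_right_limit_filtration[OF filtration_natural] by (intro INF_mono) blast
qed

section \<open>Right-continuous processes at random times\<close>

text \<open>The value at a random time \<open>R\<close> is the limit of the values at the grid times
  \<open>(\<lfloor>(k+1)R\<rfloor> + 1)/(k+1)\<close>, which approach \<open>R\<close> strictly from the right. Cutting these off at the horizon
  \<open>t\<close> ensures that only information up to \<open>t\<close> is used. If \<open>R\<close> is the time coordinate of a product
  space, the lemma gives joint measurability in time and path.\<close>

lemma measurable_right_continuous_sample:
  fixes X :: "real \<Rightarrow> 'w \<Rightarrow> real" and R :: "'w \<Rightarrow> real"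
  assumes X: "\<And>u. 0 \<le> u \<Longrightarrow> ennreal u \<le> t \<Longrightarrow> X u \<in> borel_measurable M"
    and cont: "\<And>\<omega> u. \<omega> \<in> space M \<Longrightarrow> 0 \<le> u \<Longrightarrow> ((\<lambda>s. X s \<omega>) \<longlongrightarrow> X u \<omega>) (at_right u)"
    and R: "R \<in> borel_measurable M" "\<And>\<omega>. \<omega> \<in> space M \<Longrightarrow> 0 \<le> R \<omega>"
      "\<And>\<omega>. \<omega> \<in> space M \<Longrightarrow> ennreal (R \<omega>) \<le> t"
  shows "(\<lambda>\<omega>. X (R \<omega>) \<omega>) \<in> borel_measurable M"
proof -
  define c where "c k j = enn2real (min (ennreal ((real j + 1) / (real k + 1))) t)" for k j :: nat
  define J where "J k \<omega> = nat \<lfloor>(real k + 1) * R \<omega>\<rfloor>" for k \<omega>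
  have c_le: "ennreal (c k j) \<le> t" and c_eq: "ennreal (c k j) = min (ennreal ((real j + 1) / (real k + 1))) t" for k j
    unfolding c_def by (cases "t = \<top>"; auto simp: min_def top.not_eq_extremum)+
  have meas: "(\<lambda>\<omega>. X (c k (J k \<omega>)) \<omega>) \<in> borel_measurable M" for k
  proof (rule measurable_compose_countable)
    show "X (c k j) \<in> borel_measurable M" for j
      by (rule X[OF _ c_le]) (simp add: c_def)
    show "J k \<in> M \<rightarrow>\<^sub>M count_space UNIV"
      unfolding J_def using R(1) by measurable
  qed
  show ?thesis
  proof (rule borel_measurable_LIMSEQ_metric[OF meas])
    fix \<omega> assume \<omega>: "\<omega> \<in> space M"
    define r where "r = R \<omega>"
    have r: "0 \<le> r" "ennreal r \<le> t" using R \<omega> by (auto simp: r_def)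
    have gt: "r < (real (J k \<omega>) + 1) / (real k + 1)" and le: "(real (J k \<omega>) + 1) / (real k + 1) \<le> r + 1 / (real k + 1)" for k
    proof -
      have J: "real (J k \<omega>) = of_int \<lfloor>(real k + 1) * r\<rfloor>"
        using r by (simp add: J_def r_def)
      have "(real k + 1) * r < real (J k \<omega>) + 1"
        unfolding J by linarith
      then show "r < (real (J k \<omega>) + 1) / (real k + 1)"
        by (simp add: field_simps)
      have "real (J k \<omega>) \<le> (real k + 1) * r"
        unfolding J by linarith
      then have "(real (J k \<omega>) + 1) / (real k + 1) \<le> ((real k + 1) * r + 1) / (real k + 1)"
        by (intro divide_right_mono) auto
      then show "(real (J k \<omega>) + 1) / (real k + 1) \<le> r + 1 / (real k + 1)"
        by (simp add: add_divide_distrib)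
    qed
    have c_ge: "r \<le> c k (J k \<omega>)" for k
    proof -
      have "ennreal r \<le> ennreal (c k (J k \<omega>))"
        unfolding c_eq using gt[of k] r by (auto intro: ennreal_leI less_imp_le)
      then show ?thesis by (simp add: ennreal_le_iff c_def)
    qed
    have c_up: "c k (J k \<omega>) \<le> r + 1 / (real k + 1)" for k
    proof -
      have "ennreal (c k (J k \<omega>)) \<le> ennreal (r + 1 / (real k + 1))"
        unfolding c_eq using le[of k] by (meson ennreal_leI min.coboundedI1)
      then show ?thesis using r by (subst (asm) ennreal_le_iff) auto
    qed
    have lim: "(\<lambda>k. c k (J k \<omega>)) \<longlonglongrightarrow> r"
    proof (rule tendsto_sandwich[OF _ _ tendsto_const[of r]])
      show "(\<lambda>k. r + 1 / (real k + 1)) \<longlonglongrightarrow> r"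
        using tendsto_add[OF tendsto_const[of r] LIMSEQ_inverse_real_of_nat]
        by (simp add: inverse_eq_divide add.commute)
    qed (use c_ge c_up in auto)
    have w: "((\<lambda>s. X s \<omega>) \<longlongrightarrow> X r \<omega>) (at r within {r..})"
      using cont[OF \<omega> r(1)]
      by (simp add: at_within_Ici_at_right)
    have "(\<lambda>k. X (c k (J k \<omega>)) \<omega>) \<longlonglongrightarrow> X r \<omega>"
    proof (rule topological_tendstoI)
      fix S assume "open S" "X r \<omega> \<in> S"
      then have "eventually (\<lambda>s. X s \<omega> \<in> S) (at r within {r..})"
        using w by (simp add: topological_tendstoD)
      then obtain V where V: "open V" "r \<in> V" "\<And>s. s \<in> V \<Longrightarrow> s \<noteq> r \<Longrightarrow> s \<ge> r \<Longrightarrow> X s \<omega> \<in> S"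
        unfolding eventually_at_topological by auto
      have "eventually (\<lambda>k. c k (J k \<omega>) \<in> V) sequentially"
        using lim V by (auto simp: tendsto_def)
      then show "eventually (\<lambda>k. X (c k (J k \<omega>)) \<omega> \<in> S) sequentially"
        by eventually_elim (use V(3) c_ge \<open>X r \<omega> \<in> S\<close> in metis)
    qed
    then show "(\<lambda>k. X (c k (J k \<omega>)) \<omega>) \<longlonglongrightarrow> X (R \<omega>) \<omega>"
      by (simp add: r_def)
  qed
qed

text \<open>On \<open>{T \<le> t}\<close> the time \<open>T\<close> agrees with \<open>min T t\<close>, which can be sampled with the information at
  \<open>t\<close>. If \<open>T = \<top>\<close> the sampled value is the one at time 0.\<close>

lemma measurable_stopped_value:
  fixes X :: "real \<Rightarrow> 'w \<Rightarrow> real" and T :: "'w \<Rightarrow> ennreal"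
  assumes F: "filtration \<Omega> F" and T: "stopping_time F T"
    and X: "\<And>u. 0 \<le> u \<Longrightarrow> X u \<in> borel_measurable (F (ennreal u))"
    and cont: "\<And>\<omega> u. \<omega> \<in> \<Omega> \<Longrightarrow> 0 \<le> u \<Longrightarrow> ((\<lambda>s. X s \<omega>) \<longlongrightarrow> X u \<omega>) (at_right u)"
  shows "(\<lambda>\<omega>. X (enn2real (T \<omega>)) \<omega>) \<in> borel_measurable (filtration.pre_sigma \<Omega> F T)"
proof -
  interpret filtration \<Omega> F by fact
  have *: "(\<lambda>\<omega>. X (enn2real (min (T \<omega>) t)) \<omega>) \<in> borel_measurable (F t)" for t
  proof (rule measurable_right_continuous_sample[where t=t and X=X and R="\<lambda>\<omega>. enn2real (min (T \<omega>) t)"])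
    show "X u \<in> borel_measurable (F t)" if "0 \<le> u" "ennreal u \<le> t" for u
      using X[OF that(1)] sets_F_mono[OF that(2)] by (auto simp: measurable_def space_F)
    have "(\<lambda>\<omega>. min (T \<omega>) t) \<in> borel_measurable (F t)"
    proof (rule borel_measurableI_le)
      show "{x \<in> space (F t). min (T x) t \<le> y} \<in> sets (F t)" for y
        using stopping_time_le_const[OF T, of y t]
        by (cases "t \<le> y") (auto simp: min_le_iff_disj pred_def)
    qed
    then show "(\<lambda>\<omega>. enn2real (min (T \<omega>) t)) \<in> borel_measurable (F t)"
      by measurable
    show "ennreal (enn2real (min (T \<omega>) t)) \<le> t" for \<omega>
      by (cases "min (T \<omega>) t = \<top>") (auto simp: top.not_eq_extremum)
  qed (auto simp: space_F cont)
  show ?thesis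
  proof (rule borel_measurableI_le, rule sets_pre_sigmaI[OF T])
    fix y t
    have "{\<omega> \<in> space (F t). X (enn2real (min (T \<omega>) t)) \<omega> \<le> y} \<inter> {\<omega> \<in> space (F t). T \<omega> \<le> t} \<in> sets (F t)"
      using *[of t] stopping_timeD[OF T, of t] by (intro sets.Int) (auto simp: pred_def)
    also have "{\<omega> \<in> space (F t). X (enn2real (min (T \<omega>) t)) \<omega> \<le> y} \<inter> {\<omega> \<in> space (F t). T \<omega> \<le> t}
        = {\<omega> \<in> {x \<in> space (pre_sigma T). X (enn2real (T x)) x \<le> y}. T \<omega> \<le> t}"
      by (auto simp: space_F space_pre_sigma min_absorb1)
    finally show "{\<omega> \<in> {x \<in> space (pre_sigma T). X (enn2real (T x)) x \<le> y}. T \<omega> \<le> t} \<in> sets (F t)" .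
  qed
qed

section \<open>The times \<open>\<tau>\<close> and the process \<open>N\<close>\<close>

lemma ennreal_real_between:
  fixes a b :: ennreal
  assumes "a < b"
  obtains q where "q \<in> \<rat>" "0 \<le> q" "a < ennreal q" "ennreal q < b"
proof -
  obtain r where r: "a < ennreal (real_of_rat r)" "ennreal (real_of_rat r) < b"
    using ennreal_rat_dense[OF assms] by auto
  then have "0 < real_of_rat r"
    by (metis ennreal_neg not_le not_less_zero)
  with r show thesis using that[of "real_of_rat r"] by auto
qed

context
  fixes h :: "'e::second_countable_topology option \<Rightarrow> real"
  assumes h_cont: "continuous_on UNIV h"
begin

text \<open>The path has not been exhausted by time \<open>t\<close> iff \<open>h\<close> is bounded away from 0 along the path on
  \<open>[0,t]\<close>. Right continuity at \<open>t\<close> is what pushes the bound beyond \<open>t\<close>, at the price of a slightly larger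
  \<open>n\<close>. Since only rational times and \<open>t\<close> are involved, \<open>{\<tau> > t}\<close> is measurable, although the times
  \<open>\<tau>\<^sub>n\<close> need not be.\<close>

lemma tau_gt_iff:
  assumes \<omega>: "\<omega> \<in> path_space" and t: "0 \<le> t"
  shows "ennreal t < tau h \<omega> \<longleftrightarrow> (\<exists>n\<ge>1. \<forall>s\<in>{0..t} \<inter> insert t \<rat>. 1 / real n \<le> h (\<omega> s))"
proof
  assume "ennreal t < tau h \<omega>"
  then obtain n where n: "ennreal t < tau_n h n \<omega>"
    unfolding tau_def less_SUP_iff by auto
  then have "n \<ge> 1" by (cases n) (auto simp: tau_n_def)
  moreover have "1 / real n \<le> h (\<omega> s)" if s: "0 \<le> s" "s \<le> t" for s
  proof (rule ccontr)
    assume "\<not> ?thesis"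
    then have "Inf {ennreal t | t. 0 \<le> t \<and> h (\<omega> t) \<le> 1 / real n} \<le> ennreal s"
      using s by (intro Inf_lower) auto
    then have "tau_n h n \<omega> \<le> ennreal t"
      unfolding tau_n_def using s by (meson ennreal_leI min.coboundedI2 order_trans)
    then show False using n by simp
  qed
  ultimately show "\<exists>n\<ge>1. \<forall>s\<in>{0..t} \<inter> insert t \<rat>. 1 / real n \<le> h (\<omega> s)" by auto
next
  assume "\<exists>n\<ge>1. \<forall>s\<in>{0..t} \<inter> insert t \<rat>. 1 / real n \<le> h (\<omega> s)"
  then obtain n where n1: "n \<ge> 1" and ball: "\<forall>s\<in>{0..t} \<inter> insert t \<rat>. 1 / real n \<le> h (\<omega> s)"
    by auto
  have n2: "1 / real n \<le> h (\<omega> s)" if "s \<in> \<rat> \<or> s = t" "0 \<le> s" "s \<le> t" for s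
    using ball that by auto
  note n = n1 n2
  have all: "1 / real n \<le> h (\<omega> s)" if "0 \<le> s" "s \<le> t" for s
  proof (cases "s = t")
    case False
    show ?thesis
      by (rule right_continuous_ge_if_rational[OF path_right_continuous[OF h_cont \<omega> \<open>0 \<le> s\<close>], of t])
        (use False that n(2) in auto)
  qed (use n that in auto)
  \<comment> \<open>The index \<open>m\<close> exceeds \<open>n\<close>, to leave room between \<open>1/m\<close> and \<open>1/n\<close>, and \<open>t\<close>, to beat the cap in \<open>\<tau>\<^sub>m\<close>.\<close>
  define m where "m = max (n + 1) (nat \<lceil>t\<rceil> + 1)"
  have "1 / real m < 1 / real n"
    using n by (intro divide_strict_left_mono) (auto simp: m_def)
  then have "eventually (\<lambda>s. 1 / real m < h (\<omega> s)) (at_right t)"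
    using all[of t] t by (intro order_tendstoD(1)[OF path_right_continuous[OF h_cont \<omega> t]]) auto
  then obtain b where b: "b > t" "\<And>s. t < s \<Longrightarrow> s < b \<Longrightarrow> 1 / real m < h (\<omega> s)"
    by (auto simp: eventually_at_right_field)
  have gt: "1 / real m < h (\<omega> s)" if "0 \<le> s" "s < b" for s
    using all[of s] b(2)[of s] that \<open>1 / real m < 1 / real n\<close> by (cases "s \<le> t") auto
  have "ennreal b \<le> Inf {ennreal t | t. 0 \<le> t \<and> h (\<omega> t) \<le> 1 / real m}"
  proof (intro Inf_greatest, clarify)
    fix s assume "0 \<le> s" "h (\<omega> s) \<le> 1 / real m"
    then have "b \<le> s" using gt[of s] by (meson not_le)
    then show "ennreal b \<le> ennreal s" by (rule ennreal_leI)
  qed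
  moreover have "ennreal t < ennreal b" using b t by (simp add: ennreal_less_iff)
  moreover have "ennreal t < of_nat m"
  proof -
    have "t < real m" unfolding m_def by linarith
    then show ?thesis using t by (simp add: ennreal_of_nat_eq_real_of_nat ennreal_less_iff)
  qed
  ultimately have "ennreal t < tau_n h m \<omega>"
    by (auto simp: tau_n_def)
  then show "ennreal t < tau h \<omega>"
    unfolding tau_def by (rule less_SUP_iff[THEN iffD2, OF bexI]) simp
qed

lemma h_pos_before_tau:
  assumes "0 \<le> t" "ennreal t < tau h \<omega>"
  shows "0 < h (\<omega> t)"
proof -
  obtain n where n: "ennreal t < tau_n h n \<omega>"
    using assms(2) unfolding tau_def less_SUP_iff by auto
  then have "n \<ge> 1" by (cases n) (auto simp: tau_n_def)
  have "\<not> h (\<omega> t) \<le> 1 / real n"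
  proof
    assume "h (\<omega> t) \<le> 1 / real n"
    then have "Inf {ennreal t | t. 0 \<le> t \<and> h (\<omega> t) \<le> 1 / real n} \<le> ennreal t"
      using assms(1) by (intro Inf_lower) auto
    with n show False by (auto simp: tau_n_def)
  qed
  with \<open>n \<ge> 1\<close> show ?thesis
    by (meson divide_nonneg_nonneg less_le_trans not_le of_nat_0_le_iff order_trans zero_le_one)
qed

lemma measurable_tau_gt:
  assumes t: "0 \<le> t" "ennreal t \<le> u"
  shows "{\<omega>\<in>path_space. ennreal t < tau h \<omega>} \<in> sets (G_filtration u)"
proof -
  have [measurable]: "(\<lambda>\<omega>. h (\<omega> s)) \<in> borel_measurable (G_filtration u)" if "s \<in> {0..t} \<inter> insert t \<rat>" for s
    using that t order_trans[OF ennreal_leI[of s t] t(2)]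
    by (intro measurable_compose[OF measurable_coordinate borel_measurable_continuous_onI[OF h_cont]]) auto
  have sp: "space (G_filtration u) = (path_space :: 'e path set)"
    by (rule filtration.space_F[OF filtration_G])
  have "countable ({0..t} \<inter> insert t \<rat>)"
    by (intro countable_Int2) (simp add: countable_rat)
  then have "{\<omega>\<in>space (G_filtration u). \<exists>n\<in>{1..}. \<forall>s\<in>{0..t} \<inter> insert t \<rat>. 1 / real n \<le> h (\<omega> s)} \<in> sets (G_filtration u)"
    by (intro sets.sets_Collect_countable_Bex sets.sets_Collect_countable_Ball) auto
  also have "{\<omega>\<in>space (G_filtration u). \<exists>n\<in>{1..}. \<forall>s\<in>{0..t} \<inter> insert t \<rat>. 1 / real n \<le> h (\<omega> s)}
      = {\<omega>\<in>path_space. ennreal t < tau h \<omega>}"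
    unfolding sp using tau_gt_iff[OF _ t(1)] by fastforce
  finally show ?thesis .
qed

text \<open>Before \<open>\<tau>\<close> the process is \<open>1/h\<close> with \<open>h > 0\<close>, and from \<open>\<tau>\<close> on it is constantly 0, so right
  continuity holds for every path without exception.\<close>

lemma N_right_continuous:
  assumes \<omega>: "\<omega> \<in> path_space" and t: "0 \<le> t"
  shows "((\<lambda>s. N_process h s \<omega>) \<longlongrightarrow> N_process h t \<omega>) (at_right t)"
proof (cases "ennreal t < tau h \<omega>")
  case True
  obtain b where b: "t < b" "ennreal b < tau h \<omega>"
  proof -
    obtain q where "0 \<le> q" "ennreal t < ennreal q" "ennreal q < tau h \<omega>"
      using ennreal_real_between[OF True] .
    then show thesis using that[of q] t by (auto simp: ennreal_less_iff)
  qed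
  have "((\<lambda>s. 1 / h (\<omega> s)) \<longlongrightarrow> 1 / h (\<omega> t)) (at_right t)"
    using h_pos_before_tau[OF t True]
    by (intro tendsto_divide tendsto_const path_right_continuous[OF h_cont \<omega> t]) auto
  moreover have "eventually (\<lambda>s. 1 / h (\<omega> s) = N_process h s \<omega>) (at_right t)"
    unfolding eventually_at_right_field
  proof (intro exI[of _ b] conjI allI impI)
    fix s assume "t < s" "s < b"
    then have "ennreal s < tau h \<omega>"
      using b t by (intro le_less_trans[OF ennreal_leI b(2)]) auto
    then show "1 / h (\<omega> s) = N_process h s \<omega>" by (simp add: N_process_def)
  qed (use b in auto)
  ultimately have "((\<lambda>s. N_process h s \<omega>) \<longlongrightarrow> 1 / h (\<omega> t)) (at_right t)"
    by (rule Lim_transform_eventually)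
  with True show ?thesis by (simp add: N_process_def)
next
  case False
  have "eventually (\<lambda>s. 0 = N_process h s \<omega>) (at_right t)"
    unfolding eventually_at_right_field
  proof (intro exI[of _ "t + 1"] conjI allI impI)
    fix s assume "t < s"
    then have "ennreal t \<le> ennreal s" by (intro ennreal_leI) auto
    with False have "\<not> ennreal s < tau h \<omega>" by auto
    then show "0 = N_process h s \<omega>" by (simp add: N_process_def)
  qed auto
  then have "((\<lambda>s. N_process h s \<omega>) \<longlongrightarrow> 0) (at_right t)"
    by (rule Lim_transform_eventually[OF tendsto_const])
  with False show ?thesis by (simp add: N_process_def)
qed

lemma measurable_N:
  assumes t: "0 \<le> t"
  shows "N_process h t \<in> borel_measurable (G_filtration (ennreal t))"
proof -
  have sp: "space (G_filtration (ennreal t)) = (path_space :: 'e path set)"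
    by (rule filtration.space_F[OF filtration_G])
  have [measurable]: "(\<lambda>\<omega>. h (\<omega> t)) \<in> borel_measurable (G_filtration (ennreal t))"
    by (intro measurable_compose[OF measurable_coordinate borel_measurable_continuous_onI[OF h_cont]])
      (use t in auto)
  have [measurable]: "{\<omega>\<in>path_space. ennreal t < tau h \<omega>} \<in> sets (G_filtration (ennreal t))"
    by (rule measurable_tau_gt) (use t in auto)
  have "(\<lambda>\<omega>. 1 / h (\<omega> t) * indicator {\<omega>\<in>path_space. ennreal t < tau h \<omega>} \<omega>) \<in> borel_measurable (G_filtration (ennreal t))"
    by measurable
  then show ?thesis
    by (rule measurable_cong[THEN iffD1, rotated]) (auto simp: N_process_def sp indicator_def)
qed

end

section \<open>The Foellmer measure strictly before \<open>\<tau>\<close>\<close>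

lemma tau_n_mono: "m \<le> n \<Longrightarrow> tau_n h m \<omega> \<le> tau_n h n \<omega>"
proof (cases "m = 0")
  case False
  assume "m \<le> n"
  with False have "1 / real n \<le> 1 / real m"
    by (intro divide_left_mono) auto
  then have "{ennreal t | t. 0 \<le> t \<and> h (\<omega> t) \<le> 1 / real n} \<subseteq> {ennreal t | t. 0 \<le> t \<and> h (\<omega> t) \<le> 1 / real m}"
    by force
  with \<open>m \<le> n\<close> show ?thesis
    unfolding tau_n_def by (intro min.mono Inf_superset_mono) auto
qed (simp add: tau_n_def)

lemma lifetime_top_iff: "lifetime \<omega> = \<top> \<longleftrightarrow> (\<forall>t\<ge>0. \<omega> t \<noteq> None)"
proof -
  have "(\<forall>x\<in>{ennreal t |t. 0 \<le> t \<and> \<omega> t = None}. x = \<top>) \<longleftrightarrow> (\<forall>t\<ge>0. \<omega> t \<noteq> None)"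
  proof (intro iffI ballI allI impI notI)
    fix t assume "\<forall>x\<in>{ennreal t |t. 0 \<le> t \<and> \<omega> t = None}. x = \<top>" "0 \<le> t" "\<omega> t = None"
    then have "ennreal t = \<top>" by blast
    then show False by simp
  qed auto
  then show ?thesis
    unfolding lifetime_def Inf_top_conv .
qed

interpretation G: filtration "path_space :: 'e::topological_space path set" G_filtration
  by (rule filtration_G)

lemma strict_pre_sigma_generators:
  fixes S :: "'e::topological_space path \<Rightarrow> ennreal"
  shows "sets (G_filtration 0) \<union> {{\<omega>\<in>A. ennreal t < S \<omega>} | t A. 0 \<le> t \<and> A \<in> sets (G_filtration (ennreal t))}
    \<subseteq> Pow path_space"
proof -
  have "sets (G_filtration t) \<subseteq> Pow (path_space :: 'e path set)" for t
    using sets.space_closed[of "G_filtration t :: 'e path measure"] by (simp add: G.space_F)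
  then show ?thesis by blast
qed

lemma strict_pre_sigmaI:
  fixes A :: "'e::topological_space path set"
  assumes "0 \<le> t" "A \<in> sets (G_filtration (ennreal t))"
  shows "{\<omega>\<in>A. ennreal t < S \<omega>} \<in> sets (strict_pre_sigma path_space G_filtration S)"
  unfolding strict_pre_sigma_def sets_measure_of[OF strict_pre_sigma_generators]
  using assms by (intro sigma_sets.Basic) auto

text \<open>The identity known for \<open>Q\<close> concerns events strictly before \<open>S\<close>, whereas the density is measurable
  with respect to the larger \<open>\<sigma>\<close>-algebra at \<open>S\<close>.\<close>

lemma strict_pre_sigma_le_stopped:
  fixes S :: "'e::topological_space path \<Rightarrow> ennreal"
  assumes S: "stopping_time G_filtration S"
  shows "sets (strict_pre_sigma path_space G_filtration S) \<subseteq> sets (G_stopped S)"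
proof -
  have "sets (G_filtration 0) \<union> {{\<omega>\<in>A. ennreal t < S \<omega>} | t A. 0 \<le> t \<and> A \<in> sets (G_filtration (ennreal t))}
      \<subseteq> sets (G_stopped S)"
  proof (safe)
    fix A :: "'e path set" assume A: "A \<in> sets (G_filtration 0)"
    show "A \<in> sets (G_stopped S)"
      unfolding G_stopped_def
    proof (rule G.sets_pre_sigmaI[OF S])
      fix t
      have "A \<inter> {\<omega>\<in>space (G_filtration t). S \<omega> \<le> t} \<in> sets (G_filtration t)"
        using A G.sets_F_mono[of 0 t] stopping_timeD[OF S, of t]
        by (intro sets.Int) (auto simp: pred_def)
      also have "A \<inter> {\<omega>\<in>space (G_filtration t). S \<omega> \<le> t} = {\<omega>\<in>A. S \<omega> \<le> t}"
        using sets.sets_into_space[OF A] by (auto simp: G.space_F)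
      finally show "{\<omega>\<in>A. S \<omega> \<le> t} \<in> sets (G_filtration t)" .
    qed
  next
    fix u and A :: "'e path set" assume u: "0 \<le> u" and A: "A \<in> sets (G_filtration (ennreal u))"
    show "{\<omega>\<in>A. ennreal u < S \<omega>} \<in> sets (G_stopped S)"
      unfolding G_stopped_def
    proof (rule G.sets_pre_sigmaI[OF S])
      fix t
      show "{\<omega> \<in> {\<omega>\<in>A. ennreal u < S \<omega>}. S \<omega> \<le> t} \<in> sets (G_filtration t)"
      proof (cases "ennreal u \<le> t")
        case True
        have "A \<inter> ({\<omega>\<in>space (G_filtration t). S \<omega> \<le> t} - {\<omega>\<in>space (G_filtration t). S \<omega> \<le> ennreal u})
            \<in> sets (G_filtration t)"
          using A G.sets_F_mono[OF True] stopping_timeD[OF S, of t]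
            G.stopping_time_le_const[OF S True]
          by (intro sets.Int sets.Diff) (auto simp: pred_def)
        also have "A \<inter> ({\<omega>\<in>space (G_filtration t). S \<omega> \<le> t} - {\<omega>\<in>space (G_filtration t). S \<omega> \<le> ennreal u})
            = {\<omega> \<in> {\<omega>\<in>A. ennreal u < S \<omega>}. S \<omega> \<le> t}"
          using sets.sets_into_space[OF A] by (auto simp: G.space_F not_le)
        finally show ?thesis .
      next
        case False
        then have empty: "{\<omega> \<in> {\<omega>\<in>A. ennreal u < S \<omega>}. S \<omega> \<le> t} = {}"
          by auto
        show ?thesis unfolding empty by simp
      qed
    qed
  qed
  from sets.sigma_sets_subset[OF this] show ?thesis
    unfolding strict_pre_sigma_def sets_measure_of[OF strict_pre_sigma_generators]
    by (simp add: G_stopped_def G.space_pre_sigma)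
qed

text \<open>The part of the setting that concerns \<open>P\<close>, \<open>Q\<close> and the versions \<open>T n\<close> of \<open>\<tau>\<^sub>n\<close>. The
  Foellmer measure itself is eliminated: \<open>Q\<close> coincides with it on all events strictly before \<open>T n\<close>.\<close>

locale foellmer_extension =
  fixes h :: "'e::second_countable_topology option \<Rightarrow> real"
    and P Q :: "'e path measure" and T :: "nat \<Rightarrow> 'e path \<Rightarrow> ennreal"
  assumes h_nonneg: "\<And>y. 0 \<le> h y" and h_cont: "continuous_on UNIV h"
    and sets_P: "sets P = sets G_total"
    and prob_Q: "prob_space Q" and sets_Q: "sets Q = sets G_total"
    and N_pos: "AE \<omega> in P. \<forall>t\<ge>0. 0 < N_process h t \<omega>"
    and versions: "tau_versions P h T"
    and Q_eq: "\<And>n A. n \<ge> 1 \<Longrightarrow> A \<in> sets (strict_pre_sigma path_space G_filtration (T n))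
      \<Longrightarrow> emeasure Q A = emeasure (Q_local P h (T n)) A"
begin

lemma space_P: "space P = path_space" and space_Q: "space Q = path_space"
  using sets_eq_imp_space_eq[OF sets_P] sets_eq_imp_space_eq[OF sets_Q]
  by (simp_all add: G_total_def G.space_F)

lemma sets_G_le: "sets (G_filtration t) \<subseteq> sets P" "sets (G_filtration t) \<subseteq> sets Q"
  using G.sets_F_mono[of t \<top>] by (auto simp: sets_P sets_Q G_total_def)

lemma stopping_T: "n \<ge> 1 \<Longrightarrow> stopping_time G_filtration (T n)"
  using versions by (auto simp: tau_versions_def)

lemma subalgebra_G_stopped: "n \<ge> 1 \<Longrightarrow> subalgebra P (G_stopped (T n))"
  unfolding subalgebra_def G_stopped_def G.space_pre_sigma space_P
  using G.sets_pre_sigmaD[OF stopping_T, of n _ \<top>] sets_G_le(1)[of \<top>] by auto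

definition Q_density :: "nat \<Rightarrow> 'e path \<Rightarrow> ennreal" where
  "Q_density n \<omega> = ennreal (N_process h (enn2real (T n \<omega>)) \<omega>)"

lemma Q_density_measurable_stopped: "n \<ge> 1 \<Longrightarrow> Q_density n \<in> borel_measurable (G_stopped (T n))"
  unfolding Q_density_def[abs_def] G_stopped_def
  by (intro measurable_compose[OF _ measurable_ennreal] measurable_stopped_value
      filtration_G stopping_T measurable_N N_right_continuous h_cont)

lemma Q_density_measurable: "n \<ge> 1 \<Longrightarrow> Q_density n \<in> borel_measurable P"
  using measurable_from_subalg[OF subalgebra_G_stopped Q_density_measurable_stopped] .

lemma emeasure_Q:
  assumes n: "n \<ge> 1" and A: "A \<in> sets (strict_pre_sigma path_space G_filtration (T n))"
  shows "emeasure Q A = (\<integral>\<^sup>+\<omega>. Q_density n \<omega> * indicator A \<omega> \<partial>P)"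
proof -
  have Q_local: "Q_local P h (T n) = density (restr_to_subalg P (G_stopped (T n))) (Q_density n)"
    by (simp add: Q_local_def Q_density_def[abs_def])
  have A': "A \<in> sets (G_stopped (T n))"
    using strict_pre_sigma_le_stopped[OF stopping_T[OF n]] A by auto
  have "emeasure Q A = (\<integral>\<^sup>+\<omega>. Q_density n \<omega> * indicator A \<omega> \<partial>restr_to_subalg P (G_stopped (T n)))"
    unfolding Q_eq[OF n A] Q_local
    by (rule emeasure_density)
      (use A' Q_density_measurable_stopped[OF n] in
        \<open>auto simp: sets_restr_to_subalg[OF subalgebra_G_stopped[OF n]] intro: measurable_in_subalg[OF subalgebra_G_stopped[OF n]]\<close>)
  also have "\<dots> = (\<integral>\<^sup>+\<omega>. Q_density n \<omega> * indicator A \<omega> \<partial>P)"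
  proof (rule nn_integral_subalgebra2[OF subalgebra_G_stopped[OF n]])
    note [measurable] = A' Q_density_measurable_stopped[OF n]
    show "(\<lambda>\<omega>. Q_density n \<omega> * indicator A \<omega>) \<in> borel_measurable (G_stopped (T n))"
      by measurable
  qed
  finally show ?thesis .
qed

lemma P_typical:
  "AE \<omega> in P. tau h \<omega> = \<top> \<and> (\<forall>n\<ge>1. T n \<omega> = tau_n h n \<omega>) \<and> (\<forall>n. Q_density n \<omega> > 0)"
proof -
  have "AE \<omega> in P. \<forall>n\<in>{1..}. T n \<omega> = tau_n h n \<omega>"
    using versions by (subst AE_ball_countable) (auto simp: tau_versions_def)
  then show ?thesis
    using N_pos
  proof eventually_elim
    case (elim \<omega>)
    have "tau h \<omega> = \<top>"
    proof (rule ccontr)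
      assume "tau h \<omega> \<noteq> \<top>"
      then have "\<not> ennreal (enn2real (tau h \<omega>)) < tau h \<omega>"
        by (simp add: less_top)
      then have "N_process h (enn2real (tau h \<omega>)) \<omega> = 0"
        by (simp add: N_process_def)
      with elim(2) show False by (metis enn2real_nonneg less_irrefl)
    qed
    then show ?case using elim by (auto simp: Q_density_def)
  qed
qed

lemma T_eventually_gt:
  assumes "tau h \<omega> = \<top>" "\<forall>n\<ge>1. T n \<omega> = tau_n h n \<omega>" "c < \<top>"
  obtains m0 where "m0 \<ge> 1" "\<And>m. m \<ge> m0 \<Longrightarrow> c < T m \<omega>"
proof -
  have "c < tau h \<omega>"
    using assms by simp
  then obtain n where n: "c < tau_n h n \<omega>"
    unfolding tau_def less_SUP_iff by auto
  show thesis
  proof (rule that[of "max 1 n"])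
    fix m assume "max 1 n \<le> m"
    then show "c < T m \<omega>"
      using assms(2) n tau_n_mono[of n m h \<omega>] by auto
  qed auto
qed

text \<open>The versions \<open>T n\<close> are related to \<open>\<tau>\<^sub>n\<close> under \<open>P\<close> only. Statements about them are carried over to
  \<open>Q\<close> by expressing them through events strictly before some \<open>T n\<close>, where \<open>Q\<close> has a density.\<close>

lemma null_P_imp_null_Q:
  assumes n: "n \<ge> 1" and A: "A \<in> sets (strict_pre_sigma path_space G_filtration (T n))"
    and null: "AE \<omega> in P. \<omega> \<notin> A"
  shows "AE \<omega> in Q. \<omega> \<notin> A"
proof -
  have "emeasure Q A = (\<integral>\<^sup>+\<omega>. 0 \<partial>P)"
    unfolding emeasure_Q[OF n A] by (rule nn_integral_cong_AE) (use null in auto)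
  moreover have "A \<in> sets Q"
    using A strict_pre_sigma_le_stopped[OF stopping_T[OF n]] subalgebra_G_stopped[OF n] by (auto simp: subalgebra_def sets_P sets_Q)
  ultimately show ?thesis by (intro AE_not_in) auto
qed

lemma null_Q_imp_null_P:
  assumes n: "n \<ge> 1" and A: "A \<in> sets (strict_pre_sigma path_space G_filtration (T n))"
    and null: "emeasure Q A = 0"
  shows "AE \<omega> in P. \<omega> \<notin> A"
proof -
  have [measurable]: "A \<in> sets P" "Q_density n \<in> borel_measurable P"
    using A strict_pre_sigma_le_stopped[OF stopping_T[OF n]] subalgebra_G_stopped[OF n] Q_density_measurable[OF n] by (auto simp: subalgebra_def)
  have "AE \<omega> in P. Q_density n \<omega> * indicator A \<omega> = 0"
    using null unfolding emeasure_Q[OF n A] by (subst (asm) nn_integral_0_iff_AE) auto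
  with P_typical show ?thesis
  proof eventually_elim
    case (elim \<omega>)
    then have "Q_density n \<omega> > 0" by auto
    with elim(2) show ?case by (auto simp: indicator_def split: if_splits)
  qed
qed

lemma measurable_tau_le:
  assumes "0 \<le> t"
  shows "{\<omega>\<in>path_space. tau h \<omega> \<le> ennreal t} \<in> sets (G_filtration (ennreal t))"
proof -
  have "space (G_filtration (ennreal t)) - {\<omega>\<in>path_space. ennreal t < tau h \<omega>} \<in> sets (G_filtration (ennreal t))"
    using measurable_tau_gt[OF h_cont assms order_refl] by auto
  also have "space (G_filtration (ennreal t)) - {\<omega>\<in>path_space. ennreal t < tau h \<omega>} = {\<omega>\<in>path_space. tau h \<omega> \<le> ennreal t}"
    by (auto simp: G.space_F not_less)
  finally show ?thesis .
qed

text \<open>The event \<open>{\<tau> < T m}\<close> is a countable union of the events \<open>{\<tau> \<le> q < T m}\<close>, which lie strictly before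
  \<open>T m\<close> and are null under \<open>P\<close>.\<close>

lemma T_le_tau: "AE \<omega> in Q. \<forall>m\<ge>1. T m \<omega> \<le> tau h \<omega>"
proof -
  have "AE \<omega> in Q. \<omega> \<notin> (\<Union>q\<in>\<rat> \<inter> {0..}. {\<omega>\<in>{\<omega>\<in>path_space. tau h \<omega> \<le> ennreal q}. ennreal q < T m \<omega>})"
    if m: "m \<ge> 1" for m
  proof (rule null_P_imp_null_Q[OF m])
    show "(\<Union>q\<in>\<rat> \<inter> {0..}. {\<omega>\<in>{\<omega>\<in>path_space. tau h \<omega> \<le> ennreal q}. ennreal q < T m \<omega>})
        \<in> sets (strict_pre_sigma path_space G_filtration (T m))"
    proof (intro sets.countable_UN'' countable_Int1 countable_rat)
      show "{\<omega>\<in>{\<omega>\<in>path_space. tau h \<omega> \<le> ennreal q}. ennreal q < T m \<omega>}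
          \<in> sets (strict_pre_sigma path_space G_filtration (T m))" if "q \<in> \<rat> \<inter> {0..}" for q
        by (intro strict_pre_sigmaI measurable_tau_le) (use that in auto)
    qed
    show "AE \<omega> in P. \<omega> \<notin> (\<Union>q\<in>\<rat> \<inter> {0..}. {\<omega>\<in>{\<omega>\<in>path_space. tau h \<omega> \<le> ennreal q}. ennreal q < T m \<omega>})"
      using P_typical by eventually_elim (auto simp: top_unique)
  qed
  then have "AE \<omega> in Q. \<forall>m\<in>{1..}. \<omega> \<notin> (\<Union>q\<in>\<rat> \<inter> {0..}. {\<omega>\<in>{\<omega>\<in>path_space. tau h \<omega> \<le> ennreal q}. ennreal q < T m \<omega>})"
    by (subst AE_ball_countable) auto
  with AE_space show ?thesis
  proof eventually_elim
    case (elim \<omega>)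
    show ?case
    proof (intro allI impI, rule ccontr)
      fix m :: nat assume m: "1 \<le> m" "\<not> T m \<omega> \<le> tau h \<omega>"
      then obtain q where "q \<in> \<rat>" "0 \<le> q" "tau h \<omega> < ennreal q" "ennreal q < T m \<omega>"
        using ennreal_real_between[of "tau h \<omega>" "T m \<omega>"] by (auto simp: not_le)
      with elim m show False
        by (auto simp: space_Q less_imp_le)
    qed
  qed
qed

text \<open>Since \<open>T m \<le> \<tau>\<close>, the part of \<open>B\<close> in \<open>{t < T m}\<close> is null under \<open>Q\<close>. There the density is strictly
  positive, so it is null under \<open>P\<close>, where these parts exhaust \<open>B\<close>.\<close>

lemma null_before_tau_imp_null_P:
  assumes t: "0 \<le> t" and B: "B \<in> sets (G_filtration (ennreal t))"
    and null: "AE \<omega> in Q. ennreal t < tau h \<omega> \<longrightarrow> \<omega> \<notin> B"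
  shows "AE \<omega> in P. \<omega> \<notin> B"
proof -
  have "AE \<omega> in P. \<omega> \<notin> {\<omega>\<in>B. ennreal t < T m \<omega>}" if m: "m \<in> {1..}" for m
  proof (rule null_Q_imp_null_P)
    show *: "{\<omega>\<in>B. ennreal t < T m \<omega>} \<in> sets (strict_pre_sigma path_space G_filtration (T m))"
      by (rule strict_pre_sigmaI[OF t B])
    have "AE \<omega> in Q. \<omega> \<notin> {\<omega>\<in>B. ennreal t < T m \<omega>}"
      using T_le_tau null by eventually_elim (use m in force)
    moreover have "{\<omega>\<in>B. ennreal t < T m \<omega>} \<in> sets Q"
      using * strict_pre_sigma_le_stopped[OF stopping_T, of m] subalgebra_G_stopped[of m] m by (auto simp: subalgebra_def sets_P sets_Q)
    ultimately show "emeasure Q {\<omega>\<in>B. ennreal t < T m \<omega>} = 0"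
      by (subst (asm) AE_iff_null_sets[symmetric]) (auto simp: null_sets_def)
  qed (use m in auto)
  then have "AE \<omega> in P. \<forall>m\<in>{1..}. \<omega> \<notin> {\<omega>\<in>B. ennreal t < T m \<omega>}"
    by (subst AE_ball_countable) auto
  with P_typical show ?thesis
  proof eventually_elim
    case (elim \<omega>)
    obtain m0 where "m0 \<ge> 1" "\<And>m. m \<ge> m0 \<Longrightarrow> ennreal t < T m \<omega>"
      using T_eventually_gt[of \<omega> "ennreal t"] elim by auto
    then show ?case using elim(2) by auto
  qed
qed

end

section \<open>The path just before \<open>\<tau>\<close>\<close>

lemma left_limit_ge_if_rational:
  fixes f :: "real \<Rightarrow> real"
  assumes f: "(f \<longlongrightarrow> l) (at_left t)" and "b < t"
    and ge: "\<And>q. q \<in> \<rat> \<Longrightarrow> b < q \<Longrightarrow> q < t \<Longrightarrow> c \<le> f q"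
  shows "c \<le> l"
proof (rule ccontr)
  assume "\<not> c \<le> l"
  then have "eventually (\<lambda>s. f s < c) (at_left t)"
    using order_tendstoD(2)[OF f] by auto
  then obtain a where a: "a < t" "\<And>y. a < y \<Longrightarrow> y < t \<Longrightarrow> f y < c"
    by (auto simp: eventually_at_left_field)
  obtain q where q: "q \<in> \<rat>" "max a b < q" "q < t"
    using Rats_dense_in_real[of "max a b" t] \<open>a < t\<close> \<open>b < t\<close> by auto
  with a(2)[of q] ge[of q] show False by auto
qed

context foellmer_extension
begin

text \<open>A rational time \<open>r\<close> at which the path shows that \<open>\<tau>\<^sub>n\<close> has been passed. The strict inequality for
  \<open>h\<close> makes it possible to find such a time among the rationals, by right continuity.\<close>

definition witness :: "nat \<Rightarrow> real \<Rightarrow> 'e path set" where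
  "witness n r = {\<omega>\<in>path_space. real n \<le> r \<or> h (\<omega> r) < 1 / real n}"

lemma measurable_witness: "0 \<le> r \<Longrightarrow> witness n r \<in> sets (G_filtration (ennreal r))"
proof -
  assume r: "0 \<le> r"
  have "(\<lambda>\<omega>. h (\<omega> r)) \<in> borel_measurable (G_filtration (ennreal r))"
    by (intro measurable_compose[OF measurable_coordinate borel_measurable_continuous_onI[OF h_cont]])
      (use r in auto)
  then have "{\<omega>\<in>space (G_filtration (ennreal r)). h (\<omega> r) < 1 / real n} \<in> sets (G_filtration (ennreal r))"
    unfolding borel_measurable_iff_less by blast
  moreover have "(path_space :: 'e path set) \<in> sets (G_filtration (ennreal r))"
    using sets.top[of "G_filtration (ennreal r) :: 'e path measure"] by (simp only: G.space_F)
  ultimately show ?thesis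
    by (cases "real n \<le> r") (simp_all add: witness_def G.space_F)
qed

definition reached :: "nat \<Rightarrow> nat \<Rightarrow> 'e path set" where
  "reached n m = (\<Union>r\<in>\<rat> \<inter> {0..}. {\<omega>\<in>witness n r. ennreal r < T m \<omega>})"

lemma measurable_reached: "reached n m \<in> sets (strict_pre_sigma path_space G_filtration (T m))"
  unfolding reached_def
proof (intro sets.countable_UN'' countable_Int1 countable_rat)
  show "{\<omega>\<in>witness n r. ennreal r < T m \<omega>} \<in> sets (strict_pre_sigma path_space G_filtration (T m))"
    if "r \<in> \<rat> \<inter> {0..}" for r
    using that by (intro strict_pre_sigmaI measurable_witness) auto
qed

lemma not_reached_imp_T_le:
  assumes \<omega>: "\<omega> \<in> path_space" "\<omega> \<notin> reached n m"
  shows "T m \<omega> \<le> ennreal (real n)"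
proof (rule ccontr)
  assume "\<not> ?thesis"
  then obtain q where q: "q \<in> \<rat>" "0 \<le> q" "ennreal (real n) < ennreal q" "ennreal q < T m \<omega>"
    using ennreal_real_between[of "ennreal (real n)" "T m \<omega>"] by (auto simp: not_le)
  then have "\<omega> \<in> witness n q"
    using \<omega> by (auto simp: witness_def ennreal_less_iff)
  with q \<omega> show False by (auto simp: reached_def)
qed

text \<open>Before \<open>T m\<close> the values of \<open>h\<close> are at least \<open>1/n\<close>, hence larger than \<open>1/(n+1)\<close>. So
  \<open>T (n+1)\<close> cannot come before \<open>T m\<close>, and by monotonicity the two coincide.\<close>

lemma not_reached_imp_T_eq:
  assumes \<omega>: "\<omega> \<in> path_space" "\<omega> \<notin> reached n m" and n: "1 \<le> n" and m: "n + 1 \<le> m"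
    and T: "\<forall>n\<ge>1. T n \<omega> = tau_n h n \<omega>"
  shows "T m \<omega> = T (n + 1) \<omega>"
proof (rule antisym)
  show "T (n + 1) \<omega> \<le> T m \<omega>"
    using T m tau_n_mono[OF m, of h \<omega>] by simp
  have "T m \<omega> \<le> Inf {ennreal t |t. 0 \<le> t \<and> h (\<omega> t) \<le> 1 / real (n + 1)}"
  proof (intro Inf_greatest, safe, rule ccontr)
    fix u assume u: "0 \<le> u" "h (\<omega> u) \<le> 1 / real (n + 1)" "\<not> T m \<omega> \<le> ennreal u"
    obtain b where b: "u < b" "ennreal b < T m \<omega>"
    proof -
      obtain q where "0 \<le> q" "ennreal u < ennreal q" "ennreal q < T m \<omega>"
        using ennreal_real_between[of "ennreal u" "T m \<omega>"] u by (auto simp: not_le)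
      then show thesis using that[of q] u by (auto simp: ennreal_less_iff)
    qed
    have "1 / real n \<le> h (\<omega> u)"
    proof (rule right_continuous_ge_if_rational[OF path_right_continuous[OF h_cont \<omega>(1) u(1)] b(1)])
      fix q assume q: "q \<in> \<rat>" "u < q" "q < b"
      then have "ennreal q < T m \<omega>"
        using u by (intro le_less_trans[OF ennreal_leI b(2)]) auto
      then have "\<omega> \<notin> witness n q"
        using q u \<omega>(2) by (auto simp: reached_def)
      then show "1 / real n \<le> h (\<omega> q)"
        using \<omega>(1) by (auto simp: witness_def)
    qed
    moreover have "1 / real (n + 1) < 1 / real n"
      using n by (intro divide_strict_left_mono) auto
    ultimately show False using u by auto
  qed
  moreover have "T m \<omega> \<le> of_nat (n + 1)"
    by (rule order_trans[OF not_reached_imp_T_le[OF \<omega>]])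
      (simp only: ennreal_of_nat_eq_real_of_nat, intro ennreal_leI, simp)
  ultimately show "T m \<omega> \<le> T (n + 1) \<omega>"
    using T by (simp add: tau_n_def)
qed

text \<open>Where the witness is missing, the densities at \<open>T m\<close> and at \<open>T (n+1)\<close> coincide. The latter is a fixed
  function with integral 1, and under \<open>P\<close> almost every path finds a witness, because \<open>T m\<close> tends to
  infinity. Dominated convergence finishes the argument.\<close>

lemma emeasure_not_reached_tendsto:
  assumes n: "1 \<le> n"
  shows "(\<lambda>m. emeasure Q (path_space - reached n m)) \<longlonglongrightarrow> 0"
proof -
  define C where "C m = path_space - reached n m" for m
  have C_strict: "C m \<in> sets (strict_pre_sigma path_space G_filtration (T m))" for m
  proof -
    have "space (strict_pre_sigma path_space G_filtration (T m)) = (path_space :: 'e path set)"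
      unfolding strict_pre_sigma_def by (rule space_measure_of[OF strict_pre_sigma_generators])
    with sets.compl_sets[OF measurable_reached[where n=n and m=m]] show ?thesis
      by (simp add: C_def)
  qed
  have C_sets: "C m \<in> sets P" if "m \<ge> 1" for m
    using C_strict[of m] strict_pre_sigma_le_stopped[OF stopping_T[OF that]] subalgebra_G_stopped[OF that]
    by (auto simp: subalgebra_def)
  have [measurable]: "Q_density (n + 1) \<in> borel_measurable P"
    by (rule Q_density_measurable) simp
  have sp: "path_space \<in> sets (strict_pre_sigma path_space G_filtration (T (n + 1)))"
    unfolding strict_pre_sigma_def sets_measure_of[OF strict_pre_sigma_generators]
    by (rule sigma_sets_top)
  have eq: "emeasure Q (C m) = (\<integral>\<^sup>+\<omega>. Q_density (n + 1) \<omega> * indicator (C m) \<omega> \<partial>P)" if m: "m \<ge> n + 1" for m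
  proof -
    have "emeasure Q (C m) = (\<integral>\<^sup>+\<omega>. Q_density m \<omega> * indicator (C m) \<omega> \<partial>P)"
      using m by (intro emeasure_Q C_strict) auto
    also have "\<dots> = (\<integral>\<^sup>+\<omega>. Q_density (n + 1) \<omega> * indicator (C m) \<omega> \<partial>P)"
    proof (rule nn_integral_cong_AE)
      show "AE \<omega> in P. Q_density m \<omega> * indicator (C m) \<omega> = Q_density (n + 1) \<omega> * indicator (C m) \<omega>"
        using P_typical
      proof eventually_elim
        case (elim \<omega>)
        show ?case
        proof (cases "\<omega> \<in> C m")
          case True
          then have "T m \<omega> = T (n + 1) \<omega>"
            using elim by (intro not_reached_imp_T_eq[OF _ _ n m]) (auto simp: C_def)
          then show ?thesis by (simp add: Q_density_def)
        qed simp
      qed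
    qed
    finally show ?thesis .
  qed
  have "(\<lambda>m. \<integral>\<^sup>+\<omega>. Q_density (n + 1) \<omega> * indicator (C (m + (n + 1))) \<omega> \<partial>P) \<longlonglongrightarrow> (\<integral>\<^sup>+\<omega>. 0 \<partial>P)"
  proof (rule nn_integral_dominated_convergence[where w = "Q_density (n + 1)"])
    show "(\<lambda>\<omega>. Q_density (n + 1) \<omega> * indicator (C (m + (n + 1))) \<omega>) \<in> borel_measurable P" for m
      using C_sets[of "m + (n + 1)"] by measurable
    have "(\<integral>\<^sup>+\<omega>. Q_density (n + 1) \<omega> \<partial>P) = (\<integral>\<^sup>+\<omega>. Q_density (n + 1) \<omega> * indicator path_space \<omega> \<partial>P)"
      by (rule nn_integral_cong) (simp add: space_P)
    also have "\<dots> = emeasure Q path_space"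
      using sp by (intro emeasure_Q[symmetric]) auto
    also have "\<dots> = 1"
      using prob_space.emeasure_space_1[OF prob_Q] by (simp add: space_Q)
    finally show "(\<integral>\<^sup>+\<omega>. Q_density (n + 1) \<omega> \<partial>P) < \<infinity>" by simp
    show "AE \<omega> in P. (\<lambda>m. Q_density (n + 1) \<omega> * indicator (C (m + (n + 1))) \<omega>) \<longlonglongrightarrow> 0"
      using P_typical
    proof eventually_elim
      case (elim \<omega>)
      then have "tau h \<omega> = \<top>" "\<forall>n\<ge>1. T n \<omega> = tau_n h n \<omega>"
        by auto
      from T_eventually_gt[OF this ennreal_less_top[of "real n"]]
      obtain m0 where m0: "\<And>m. m \<ge> m0 \<Longrightarrow> ennreal (real n) < T m \<omega>"
        by blast
      have "\<omega> \<notin> C (m + (n + 1))" if "m \<ge> m0" for m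
        using not_reached_imp_T_le[of \<omega> n "m + (n + 1)"] m0[of "m + (n + 1)"] that
        by (auto simp: C_def not_less[symmetric])
      then have "eventually (\<lambda>m. 0 = Q_density (n + 1) \<omega> * indicator (C (m + (n + 1))) \<omega>) sequentially"
        by (intro eventually_sequentiallyI[of m0]) simp
      then show ?case by (rule Lim_transform_eventually[OF tendsto_const])
    qed
  qed (use Q_density_measurable[of "n + 1"] in \<open>auto simp: indicator_def\<close>)
  then have "(\<lambda>m. emeasure Q (C (m + (n + 1)))) \<longlonglongrightarrow> 0"
    using eq by simp
  then show ?thesis
    unfolding C_def by (rule LIMSEQ_offset)
qed

text \<open>This expresses \<open>\<tau>\<^sub>n < \<tau>\<close> for all \<open>n\<close>: the path does not jump into \<open>{h = 0}\<close>.\<close>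

lemma witness_before_tau:
  "AE \<omega> in Q. \<forall>n\<ge>1. \<exists>r\<in>\<rat> \<inter> {0..}. ennreal r < tau h \<omega> \<and> \<omega> \<in> witness n r"
proof -
  have "AE \<omega> in Q. \<exists>m\<ge>1. \<omega> \<in> reached n m" if n: "n \<in> {1..}" for n
  proof (rule AE_I)
    have R: "reached n m \<in> sets Q" if "m \<ge> 1" for m
      using measurable_reached[where n=n and m=m] strict_pre_sigma_le_stopped[OF stopping_T[OF that]] subalgebra_G_stopped[OF that]
      by (auto simp: subalgebra_def sets_P sets_Q)
    define M where "M = (\<Inter>m\<in>{1..}. space Q - reached n m)"
    show M_sets: "M \<in> sets Q"
      unfolding M_def using R by (intro sets.countable_INT') auto
    show "{\<omega> \<in> space Q. \<not> (\<exists>m\<ge>1. \<omega> \<in> reached n m)} \<subseteq> M"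
      by (auto simp: M_def)
    have "emeasure Q M \<le> emeasure Q (path_space - reached n m)" if "m \<ge> 1" for m
      using that R[of m] sets.top[of Q] by (intro emeasure_mono) (auto simp: M_def space_Q)
    then have "eventually (\<lambda>m. emeasure Q M \<le> emeasure Q (path_space - reached n m)) sequentially"
      by (auto simp: eventually_sequentially)
    then have "emeasure Q M \<le> 0"
      using n by (intro tendsto_lowerbound[OF emeasure_not_reached_tendsto[of n]]) auto
    then show "emeasure Q M = 0" by simp
  qed
  then have "AE \<omega> in Q. \<forall>n\<in>{1..}. \<exists>m\<ge>1. \<omega> \<in> reached n m"
    by (subst AE_ball_countable) auto
  with T_le_tau show ?thesis
  proof eventually_elim
    case (elim \<omega>)
    show ?case
    proof (intro allI impI)
      fix n :: nat assume "1 \<le> n"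
      with elim(2) have "\<exists>m\<ge>1. \<omega> \<in> reached n m" by auto
      then obtain m r where r: "m \<ge> 1" "r \<in> \<rat> \<inter> {0..}" "\<omega> \<in> witness n r" "ennreal r < T m \<omega>"
        unfolding reached_def by blast
      from elim(1) r(1) have "T m \<omega> \<le> tau h \<omega>" by blast
      with r(4) have "ennreal r < tau h \<omega>" by (rule less_le_trans)
      with r show "\<exists>r\<in>\<rat> \<inter> {0..}. ennreal r < tau h \<omega> \<and> \<omega> \<in> witness n r"
        by blast
    qed
  qed
qed

text \<open>If \<open>g\<close> were at least \<open>\<epsilon>\<close> on \<open>[s,\<tau>)\<close>, the left limit \<open>y\<close> of the path at \<open>\<tau>\<close> would satisfy
  \<open>g y \<ge> \<epsilon>\<close> and therefore \<open>h y > 0\<close>. Then \<open>h\<close> would be bounded away from 0 on all of \<open>[0,\<tau>)\<close>, which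
  contradicts the existence of witnesses for large \<open>n\<close>.\<close>

lemma close_before_tau:
  fixes g :: "'e option \<Rightarrow> real"
  assumes \<omega>: "\<omega> \<in> path_space" and life: "lifetime \<omega> = \<top>"
    and wit: "\<forall>n\<ge>1. \<exists>r\<in>\<rat> \<inter> {0..}. ennreal r < tau h \<omega> \<and> \<omega> \<in> witness n r"
    and g: "continuous_on UNIV g" "\<And>y. h (Some y) = 0 \<Longrightarrow> g (Some y) = 0"
    and \<epsilon>: "0 < \<epsilon>" and s: "0 \<le> s" "ennreal s < tau h \<omega>" and t: "tau h \<omega> \<le> ennreal t"
  shows "\<exists>u\<in>\<rat>. s \<le> u \<and> ennreal u < tau h \<omega> \<and> g (\<omega> u) < \<epsilon>"
proof (rule ccontr)
  assume contra: "\<not> ?thesis"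
  define v where "v = enn2real (tau h \<omega>)"
  have v: "tau h \<omega> = ennreal v"
    using le_less_trans[OF t ennreal_less_top] by (simp add: v_def)
  have "s < v" using s(2) s(1) by (simp add: v ennreal_less_iff)
  have "\<forall>t>0. ennreal t < lifetime \<omega> \<longrightarrow> (\<exists>l. (\<omega> \<longlongrightarrow> l) (at_left t))"
    using \<omega> unfolding path_space_def by blast
  moreover have "0 < v" "ennreal v < lifetime \<omega>"
    using s(1) \<open>s < v\<close> by (simp_all add: life)
  ultimately obtain l where l: "(\<omega> \<longlongrightarrow> l) (at_left v)"
    by blast
  have ev_pos: "eventually (\<lambda>u. s < u \<and> u < v) (at_left v)"
    unfolding eventually_at_left_field using \<open>s < v\<close> by auto
  \<comment> \<open>Since \<open>None\<close> is isolated, the left limit \<open>None\<close> would put the path there before \<open>v\<close>.\<close>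
  obtain y where y: "l = Some y"
  proof (cases l)
    case None
    have "open {None :: 'e option}" by (simp add: open_option_def vimage_def)
    then have "eventually (\<lambda>u. \<omega> u \<in> {None}) (at_left v)"
      using l None by (intro topological_tendstoD) auto
    with ev_pos have "eventually (\<lambda>u. False) (at_left v)"
    proof eventually_elim
      case (elim u)
      moreover have "\<omega> u \<noteq> None"
        using life elim s(1) unfolding lifetime_top_iff by (meson less_eq_real_def order_trans)
      ultimately show False by simp
    qed
    then show thesis by simp
  qed auto
  have lim: "((\<lambda>u. f (\<omega> u)) \<longlongrightarrow> f (Some y)) (at_left v)" if "continuous_on UNIV f" for f :: "'e option \<Rightarrow> real"
    using continuous_on_tendsto_compose[OF that l] y by auto
  have "\<epsilon> \<le> g (Some y)"
  proof (rule left_limit_ge_if_rational[OF lim[OF g(1)] \<open>s < v\<close>])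
    fix q assume "q \<in> \<rat>" "s < q" "q < v"
    with contra s show "\<epsilon> \<le> g (\<omega> q)"
      by (auto simp: v ennreal_less_iff not_less)
  qed
  then have "0 < h (Some y)"
    using g(2)[of y] \<epsilon> h_nonneg[of "Some y"] by (cases "h (Some y) = 0") auto
  define c where "c = h (Some y) / 2"
  have "c > 0" "c < h (Some y)" using \<open>0 < h (Some y)\<close> by (auto simp: c_def)
  have "eventually (\<lambda>u. c < h (\<omega> u)) (at_left v)"
    using order_tendstoD(1)[OF lim[OF h_cont] \<open>c < h (Some y)\<close>] .
  then obtain b where b: "b < v" "\<And>u. b < u \<Longrightarrow> u < v \<Longrightarrow> c < h (\<omega> u)"
    by (auto simp: eventually_at_left_field)
  \<comment> \<open>Beyond \<open>b\<close> the bound is \<open>c\<close>, up to the time \<open>b'\<close> in \<open>(b,\<tau>)\<close> it comes from \<open>\<tau> > b'\<close>.\<close>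
  define b' where "b' = (max b s + v) / 2"
  have b': "b < b'" "0 \<le> b'" "b' < v"
    using b(1) \<open>s < v\<close> s(1) by (auto simp: b'_def max_def)
  then have "ennreal b' < tau h \<omega>"
    by (simp add: v ennreal_less_iff)
  then obtain n where n: "n \<ge> 1" "\<forall>s\<in>{0..b'} \<inter> insert b' \<rat>. 1 / real n \<le> h (\<omega> s)"
    using tau_gt_iff[OF h_cont \<omega> \<open>0 \<le> b'\<close>] by auto
  obtain k where k: "max v (1 / c) < real k"
    using reals_Archimedean2 by blast
  define N where "N = max n k"
  have "real k \<le> real N" by (simp add: N_def)
  have "N \<ge> 1" using n by (simp add: N_def)
  then obtain r where r: "r \<in> \<rat>" "0 \<le> r" "ennreal r < tau h \<omega>" "\<omega> \<in> witness N r"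
    using wit by auto
  have "r < v" using r by (simp add: v ennreal_less_iff)
  moreover have "v < real N" using k \<open>real k \<le> real N\<close> by auto
  ultimately have small: "h (\<omega> r) < 1 / real N"
    using r(4) by (auto simp: witness_def)
  show False
  proof (cases "r \<le> b'")
    case True
    then have "1 / real n \<le> h (\<omega> r)" using n r by auto
    moreover have "1 / real N \<le> 1 / real n"
      using n by (intro divide_left_mono) (auto simp: N_def)
    ultimately show False using small by simp
  next
    case False
    then have "c < h (\<omega> r)" using b(2)[of r] b' \<open>r < v\<close> by auto
    moreover have "1 / real N \<le> c"
    proof -
      have "1 / c \<le> real N" using k \<open>real k \<le> real N\<close> by auto
      then show ?thesis using \<open>c > 0\<close> \<open>N \<ge> 1\<close> by (simp add: field_simps)
    qed
    ultimately show False using small by simp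
  qed
qed

end

section \<open>Survival probabilities and their decomposition\<close>

text \<open>Positivity of \<open>Z\<close> is added only in the next locale, because it will be derived from the survival
  probabilities computed here.\<close>

locale survival = prob_space Q + F: filtration "space Q" F
  for Q :: "'w measure" and F :: "ennreal \<Rightarrow> 'w measure" +
  fixes \<tau> :: "'w \<Rightarrow> ennreal" and Z :: "real \<Rightarrow> 'w \<Rightarrow> real"
  assumes sets_F_le: "\<And>t. sets (F t) \<subseteq> sets Q"
    and survival_event: "\<And>t. 0 \<le> t \<Longrightarrow> {\<omega>\<in>space Q. ennreal t < \<tau> \<omega>} \<in> sets Q"
    and Z_adapted: "adapted F Z"
    and Z_cond_exp: "\<And>t. 0 \<le> t \<Longrightarrow>
      AE \<omega> in Q. Z t \<omega> = real_cond_exp Q (F (ennreal t)) (indicator {\<omega>. ennreal t < \<tau> \<omega>}) \<omega>"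
begin

lemma subalg: "subalgebra Q (F t)"
  using sets_F_le by (simp add: subalgebra_def F.space_F)

lemma cond: "sigma_finite_subalgebra Q (F t)"
  by (intro finite_measure_subalgebra_is_sigma_finite)
    (unfold_locales, rule subalg)

lemma measurable_F: "f \<in> borel_measurable (F t) \<Longrightarrow> f \<in> borel_measurable Q"
  using measurable_from_subalg[OF subalg] .

lemma adapted_later:
  assumes "adapted F X" "0 \<le> s" "ennreal s \<le> t"
  shows "X s \<in> borel_measurable (F t)"
  using assms F.sets_F_mono[of "ennreal s" t] by (auto simp: adapted_def measurable_def F.space_F)

text \<open>Integrating \<open>Z\<close> over an event of the filtration gives back the probability of survival on that event.
  For a time with finitely many values this is \<open>E[Z\<^sub>\<rho>] = Q(\<tau> > \<rho>)\<close>, applied to each value.\<close>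

lemma survival_probability:
  assumes u: "0 \<le> u" and H: "H \<in> sets (F (ennreal u))"
  shows "(\<integral>\<^sup>+\<omega>. ennreal (Z u \<omega>) * indicator H \<omega> \<partial>Q) = emeasure Q {\<omega>\<in>H. ennreal u < \<tau> \<omega>}"
proof -
  interpret sigma_finite_subalgebra Q "F (ennreal u)" by (rule cond)
  define f where "f = (indicator {\<omega>. ennreal u < \<tau> \<omega>} :: 'w \<Rightarrow> real)"
  have H': "H \<in> sets Q" using H sets_F_le by auto
  have S: "{\<omega>\<in>H. ennreal u < \<tau> \<omega>} \<in> sets Q"
  proof -
    have "H \<inter> {\<omega>\<in>space Q. ennreal u < \<tau> \<omega>} \<in> sets Q"
      using H' survival_event[OF u] by auto
    also have "H \<inter> {\<omega>\<in>space Q. ennreal u < \<tau> \<omega>} = {\<omega>\<in>H. ennreal u < \<tau> \<omega>}"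
      using sets.sets_into_space[OF H'] by auto
    finally show ?thesis .
  qed
  have f_meas: "f \<in> borel_measurable Q"
    by (rule measurable_cong[THEN iffD1, OF _ borel_measurable_indicator[OF survival_event[OF u]]])
      (auto simp: f_def indicator_def)
  have f: "integrable Q f"
    by (rule integrable_const_bound[where B=1, OF _ f_meas]) (auto simp: f_def)
  have Zf: "AE \<omega> in Q. Z u \<omega> = real_cond_exp Q (F (ennreal u)) f \<omega>"
    using Z_cond_exp[OF u] by (simp add: f_def)
  have "AE \<omega> in Q. 0 \<le> real_cond_exp Q (F (ennreal u)) f \<omega>"
    by (rule real_cond_exp_pos) (auto simp: f_def f_meas[unfolded f_def])
  with Zf have Z_nonneg: "AE \<omega> in Q. 0 \<le> Z u \<omega>"
    by eventually_elim simp
  have Z_meas: "Z u \<in> borel_measurable Q"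
    using measurable_F[OF adapted_later[OF Z_adapted u order_refl]] .
  have Z_int: "integrable Q (Z u)"
    using real_cond_exp_int(1)[OF f] Zf Z_meas by (subst integrable_cong_AE) auto
  have ZH_int: "integrable Q (\<lambda>\<omega>. indicator H \<omega> * Z u \<omega>)"
    using integrable_mult_indicator[OF H' Z_int] by simp
  have "(\<integral>\<^sup>+\<omega>. ennreal (Z u \<omega>) * indicator H \<omega> \<partial>Q) = (\<integral>\<^sup>+\<omega>. ennreal (indicator H \<omega> * Z u \<omega>) \<partial>Q)"
    by (intro nn_integral_cong) (auto simp: indicator_def)
  also have "\<dots> = ennreal (\<integral>\<omega>. indicator H \<omega> * Z u \<omega> \<partial>Q)"
    by (rule nn_integral_eq_integral[OF ZH_int]) (use Z_nonneg in \<open>eventually_elim, auto\<close>)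
  also have "(\<integral>\<omega>. indicator H \<omega> * Z u \<omega> \<partial>Q) = (\<integral>\<omega>\<in>H. real_cond_exp Q (F (ennreal u)) f \<omega> \<partial>Q)"
    unfolding set_lebesgue_integral_def
    using Zf Z_meas H' real_cond_exp_int(1)[OF f]
    by (intro integral_cong_AE) (auto intro!: borel_measurable_times)
  also have "\<dots> = (\<integral>\<omega>\<in>H. f \<omega> \<partial>Q)"
    by (rule real_cond_exp_intA[symmetric, OF f H])
  also have "\<dots> = (\<integral>\<omega>. indicator {\<omega>\<in>H. ennreal u < \<tau> \<omega>} \<omega> \<partial>Q)"
    unfolding set_lebesgue_integral_def f_def by (intro Bochner_Integration.integral_cong) (auto simp: indicator_def)
  also have "ennreal \<dots> = emeasure Q {\<omega>\<in>H. ennreal u < \<tau> \<omega>}"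
    using S by (simp add: emeasure_eq_measure)
  finally show ?thesis .
qed

end

locale multiplicative_survival = survival Q F \<tau> Z
  for Q :: "'w measure" and F \<tau> Z +
  fixes \<Lambda> K :: "real \<Rightarrow> 'w \<Rightarrow> real"
  assumes Z_pos: "\<And>t. 0 \<le> t \<Longrightarrow> AE \<omega> in Q. 0 < Z t \<omega>"
    and K_local_martingale: "local_martingale Q F K"
    and \<Lambda>_mono: "AE \<omega> in Q. \<Lambda> 0 \<omega> = 0 \<and> mono_on {0..} (\<lambda>t. \<Lambda> t \<omega>)"
    and Z_eq: "AE \<omega> in Q. \<forall>t\<ge>0. Z t \<omega> = exp (- \<Lambda> t \<omega>) * K t \<omega>"
begin

text \<open>The sign of \<open>K\<close> is that of \<open>Z\<close>, which is positive at all rational times simultaneously; right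
  continuity of \<open>K\<close> yields the remaining times.\<close>

lemma K_nonneg: "AE \<omega> in Q. \<forall>t\<ge>0. 0 \<le> K t \<omega>"
proof -
  have "AE \<omega> in Q. \<forall>q\<in>\<rat> \<inter> {0..}. 0 < Z q \<omega>"
    using Z_pos by (subst AE_ball_countable) (auto intro: countable_Int1 countable_rat)
  moreover have "AE \<omega> in Q. cadlag (\<lambda>t. K t \<omega>)"
    using K_local_martingale by (simp add: local_martingale_def)
  ultimately show ?thesis
    using Z_eq
  proof eventually_elim
    case (elim \<omega>)
    show ?case
    proof (intro allI impI)
      fix t :: real assume t: "0 \<le> t"
      show "0 \<le> K t \<omega>"
      proof (rule right_continuous_ge_if_rational[where f="\<lambda>t. K t \<omega>" and t=t and b="t + 1"])
        show "((\<lambda>t. K t \<omega>) \<longlongrightarrow> K t \<omega>) (at_right t)"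
          using elim(2) t by (simp add: cadlag_def)
        fix q assume q: "q \<in> \<rat>" "t < q"
        then have "0 < exp (- \<Lambda> q \<omega>) * K q \<omega>"
          using elim(1,3) t by auto
        then show "0 \<le> K q \<omega>"
          by (simp add: zero_less_mult_iff)
      qed simp
    qed
  qed
qed

text \<open>A version of \<open>exp(-\<Lambda>\<^sub>s) = Z\<^sub>s / K\<^sub>s\<close> that is bounded and measurable at time \<open>s\<close>, with no
  exceptional set of paths.\<close>

definition weight :: "real \<Rightarrow> 'w \<Rightarrow> real" where
  "weight s \<omega> = max 0 (min 1 (Z s \<omega> / K s \<omega>))"

lemma weight_bounds: "0 \<le> weight s \<omega>" "weight s \<omega> \<le> 1"
  by (auto simp: weight_def)

lemma K_adapted: "adapted F K"
  using K_local_martingale by (simp add: local_martingale_def)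

lemma measurable_weight: "0 \<le> s \<Longrightarrow> weight s \<in> borel_measurable (F (ennreal s))"
  unfolding weight_def[abs_def]
  using adapted_later[OF Z_adapted, of s "ennreal s"] adapted_later[OF K_adapted, of s "ennreal s"]
  by (intro borel_measurable_max borel_measurable_min borel_measurable_divide borel_measurable_const) auto

lemma weight_eq:
  assumes s: "0 \<le> s"
  shows "AE \<omega> in Q. weight s \<omega> = exp (- \<Lambda> s \<omega>)"
  using Z_pos[OF s] Z_eq \<Lambda>_mono
proof eventually_elim
  case (elim \<omega>)
  then have "Z s \<omega> = exp (- \<Lambda> s \<omega>) * K s \<omega>" using s by auto
  with elim(1) have "Z s \<omega> / K s \<omega> = exp (- \<Lambda> s \<omega>)" by auto
  moreover have "\<Lambda> 0 \<omega> \<le> \<Lambda> s \<omega>"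
    using elim(3) s by (intro mono_onD[of "{0..}" "\<lambda>t. \<Lambda> t \<omega>"]) auto
  ultimately show ?case using elim(3) by (simp add: weight_def)
qed

lemma weighted_K_eq:
  assumes s: "0 \<le> s"
  shows "AE \<omega> in Q. K s \<omega> * weight s \<omega> = Z s \<omega>"
  using weight_eq[OF s] Z_eq by eventually_elim (use s in auto)

text \<open>Monotonicity of \<open>\<Lambda>\<close> acts through the identity
  \<open>K\<^sub>u exp(-\<Lambda>\<^sub>s) = exp(\<Lambda>\<^sub>u - \<Lambda>\<^sub>s) Z\<^sub>u\<close>.\<close>

lemma weighted_K_ge:
  assumes s: "0 \<le> s" and u: "s \<le> u"
  shows "AE \<omega> in Q. Z u \<omega> \<le> K u \<omega> * weight s \<omega>"
  using weight_eq[OF s] Z_eq \<Lambda>_mono K_nonneg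
proof eventually_elim
  case (elim \<omega>)
  have "exp (- \<Lambda> u \<omega>) \<le> weight s \<omega>"
    using elim s u by (auto simp: mono_on_def)
  then have "exp (- \<Lambda> u \<omega>) * K u \<omega> \<le> weight s \<omega> * K u \<omega>"
    using elim(4) s u by (intro mult_right_mono) auto
  then show ?case using elim(2) s u by (simp add: mult.commute)
qed

text \<open>The martingale property tested against a bounded weight that is known at time \<open>u\<close>.\<close>

lemma martingale_swap:
  assumes Y: "martingale Q F Y" and u: "0 \<le> u" "u \<le> t"
    and V: "V \<in> borel_measurable (F (ennreal u))" "\<And>\<omega>. 0 \<le> V \<omega>" "\<And>\<omega>. V \<omega> \<le> 1"
  shows "integrable Q (\<lambda>\<omega>. V \<omega> * Y u \<omega>)" "integrable Q (\<lambda>\<omega>. V \<omega> * Y t \<omega>)"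
    "(\<integral>\<omega>. V \<omega> * Y u \<omega> \<partial>Q) = (\<integral>\<omega>. V \<omega> * Y t \<omega> \<partial>Q)"
proof -
  interpret sigma_finite_subalgebra Q "F (ennreal u)" by (rule cond)
  have V': "V \<in> borel_measurable Q" by (rule measurable_F[OF V(1)])
  have int: "integrable Q (\<lambda>\<omega>. V \<omega> * Y r \<omega>)" if "0 \<le> r" for r
  proof (rule Bochner_Integration.integrable_bound)
    show Yr: "integrable Q (Y r)" using Y that by (simp add: martingale_def)
    show "(\<lambda>\<omega>. V \<omega> * Y r \<omega>) \<in> borel_measurable Q"
      using V' Yr by (intro borel_measurable_times) auto
    show "AE \<omega> in Q. norm (V \<omega> * Y r \<omega>) \<le> norm (Y r \<omega>)"
      using V(2,3) by (auto simp: abs_mult intro!: mult_left_le_one_le)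
  qed
  show i: "integrable Q (\<lambda>\<omega>. V \<omega> * Y u \<omega>)" "integrable Q (\<lambda>\<omega>. V \<omega> * Y t \<omega>)"
    using int u by auto
  have "integrable Q (Y t)" using Y u by (simp add: martingale_def)
  then have Yt: "Y t \<in> borel_measurable Q" by (rule borel_measurable_integrable)
  have "AE \<omega> in Q. real_cond_exp Q (F (ennreal u)) (Y t) \<omega> = Y u \<omega>"
    using Y u by (simp add: martingale_def)
  then have "(\<integral>\<omega>. V \<omega> * real_cond_exp Q (F (ennreal u)) (Y t) \<omega> \<partial>Q) = (\<integral>\<omega>. V \<omega> * Y u \<omega> \<partial>Q)"
    using i V' real_cond_exp_intg(1)[OF i(2) V(1) Yt] by (intro integral_cong_AE) auto
  then show "(\<integral>\<omega>. V \<omega> * Y u \<omega> \<partial>Q) = (\<integral>\<omega>. V \<omega> * Y t \<omega> \<partial>Q)"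
    using real_cond_exp_intg(2)[OF i(2) V(1) Yt] by simp
qed

text \<open>Optional stopping for the time \<open>\<rho>\<close> that equals \<open>u\<close> on \<open>H u\<close>. For the stopped martingale \<open>Y\<close> the value
  at \<open>u\<close> may be replaced by the one at \<open>t\<close> on each \<open>H u\<close>; summing over the partition and going back from
  \<open>t\<close> to \<open>s\<close> leaves \<open>E[Y\<^sub>s V] \<le> E[Z\<^sub>s]\<close>. The restriction to \<open>{t \<le> T}\<close> identifies \<open>Y\<close> with \<open>K\<close>.\<close>

lemma stopped_partition_bound:
  assumes T: "stopping_time F T" and Y: "martingale Q F (stopped K T)"
    and s: "0 \<le> s" and U: "finite U" "U \<subseteq> {s..t}" and st: "s \<le> t"
    and H: "\<And>u. u \<in> U \<Longrightarrow> H u \<in> sets (F (ennreal u))"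
    and disj: "disjoint_family_on H U" and cover: "(\<Union>u\<in>U. H u) = space Q"
  shows "(\<integral>\<^sup>+\<omega>. (\<Sum>u\<in>U. ennreal (K u \<omega> * weight s \<omega>) * indicator (H u) \<omega>) * indicator {\<omega>. ennreal t \<le> T \<omega>} \<omega> \<partial>Q)
    \<le> emeasure Q {\<omega>\<in>space Q. ennreal s < \<tau> \<omega>}" (is "?L \<le> ?R")
proof -
  define Y where "Y = stopped K T"
  define V where "V \<omega> = weight s \<omega> * indicator {\<omega>\<in>space Q. ennreal s \<le> T \<omega>} \<omega>" for \<omega>
  have mart: "martingale Q F Y" using Y by (simp add: Y_def)
  have V01: "0 \<le> V \<omega>" "V \<omega> \<le> 1" for \<omega>
    using weight_bounds by (auto simp: V_def indicator_def)
  have V_meas: "V \<in> borel_measurable (F (ennreal u))" if "s \<le> u" for u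
  proof -
    have "{\<omega>\<in>space (F (ennreal s)). \<not> T \<omega> < ennreal s} \<in> sets (F (ennreal s))"
      using F.stopping_time_less_const[OF T, of "ennreal s"] by (intro sets.sets_Collect_neg) (simp add: pred_def)
    then have "{\<omega>\<in>space Q. ennreal s \<le> T \<omega>} \<in> sets (F (ennreal s))"
      by (simp add: F.space_F not_less)
    then have "V \<in> borel_measurable (F (ennreal s))"
      unfolding V_def[abs_def] using measurable_weight[OF s]
      by (intro borel_measurable_times borel_measurable_indicator) auto
    then show ?thesis
      using F.sets_F_mono[OF ennreal_leI[OF that]] by (auto simp: measurable_def F.space_F)
  qed
  have U': "s \<le> u" "u \<le> t" if "u \<in> U" for u using U(2) that by auto
  have VH01: "0 \<le> V \<omega> * indicator (H u) \<omega>" "V \<omega> * indicator (H u) \<omega> \<le> 1" for u \<omega>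
    using V01[of \<omega>] by (auto simp: indicator_def)
  have VH_meas: "(\<lambda>\<omega>. V \<omega> * indicator (H u) \<omega>) \<in> borel_measurable (F (ennreal u))" if "u \<in> U" for u
    using V_meas[OF U'(1)[OF that]] H[OF that]
    by (intro borel_measurable_times borel_measurable_indicator)
  note swap = martingale_swap[OF mart _ _ VH_meas VH01]
  have Y_nonneg: "AE \<omega> in Q. \<forall>u\<ge>0. 0 \<le> Y u \<omega>"
    using K_nonneg by eventually_elim (auto simp: Y_def stopped_def)
  have Y_eq: "Y u \<omega> = K u \<omega>" if "0 \<le> u" "ennreal u \<le> T \<omega>" for u \<omega>
    using that by (simp add: Y_def stopped_def min_absorb1)
  have "?L \<le> (\<integral>\<^sup>+\<omega>. (\<Sum>u\<in>U. ennreal (V \<omega> * indicator (H u) \<omega> * Y u \<omega>)) \<partial>Q)"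
  proof (rule nn_integral_mono)
    fix \<omega> assume \<omega>: "\<omega> \<in> space Q"
    show "(\<Sum>u\<in>U. ennreal (K u \<omega> * weight s \<omega>) * indicator (H u) \<omega>) * indicator {\<omega>. ennreal t \<le> T \<omega>} \<omega>
        \<le> (\<Sum>u\<in>U. ennreal (V \<omega> * indicator (H u) \<omega> * Y u \<omega>))"
    proof (cases "ennreal t \<le> T \<omega>")
      case True
      have "ennreal (K u \<omega> * weight s \<omega>) * indicator (H u) \<omega> = ennreal (V \<omega> * indicator (H u) \<omega> * Y u \<omega>)"
        if "u \<in> U" for u
      proof -
        have "ennreal u \<le> T \<omega>" "ennreal s \<le> T \<omega>"
          using order_trans[OF ennreal_leI True] U'[OF that] st by auto
        then show ?thesis
          using Y_eq[of u \<omega>] U'[OF that] s \<omega> by (auto simp: V_def indicator_def mult.commute)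
      qed
      then show ?thesis using True by simp
    qed simp
  qed
  also have "\<dots> = (\<Sum>u\<in>U. \<integral>\<^sup>+\<omega>. ennreal (V \<omega> * indicator (H u) \<omega> * Y u \<omega>) \<partial>Q)"
  proof (rule nn_integral_sum)
    fix u assume u: "u \<in> U"
    have "integrable Q (\<lambda>\<omega>. V \<omega> * indicator (H u) \<omega> * Y u \<omega>)"
      using swap(1)[of u t] U'[OF u] s u by auto
    then show "(\<lambda>\<omega>. ennreal (V \<omega> * indicator (H u) \<omega> * Y u \<omega>)) \<in> borel_measurable Q"
      by (intro measurable_compose[OF borel_measurable_integrable measurable_ennreal])
  qed
  also have "\<dots> = (\<Sum>u\<in>U. ennreal (\<integral>\<omega>. V \<omega> * indicator (H u) \<omega> * Y u \<omega> \<partial>Q))"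
  proof (intro sum.cong refl nn_integral_eq_integral)
    fix u assume u: "u \<in> U"
    show "integrable Q (\<lambda>\<omega>. V \<omega> * indicator (H u) \<omega> * Y u \<omega>)"
      using swap(1)[of u t] U'[OF u] s u by auto
    show "AE \<omega> in Q. 0 \<le> V \<omega> * indicator (H u) \<omega> * Y u \<omega>"
      using Y_nonneg by eventually_elim (use VH01 U'[OF u] s in auto)
  qed
  also have "\<dots> = (\<Sum>u\<in>U. ennreal (\<integral>\<omega>. V \<omega> * indicator (H u) \<omega> * Y t \<omega> \<partial>Q))"
  proof (intro sum.cong refl arg_cong[where f=ennreal])
    fix u assume u: "u \<in> U"
    show "(\<integral>\<omega>. V \<omega> * indicator (H u) \<omega> * Y u \<omega> \<partial>Q) = (\<integral>\<omega>. V \<omega> * indicator (H u) \<omega> * Y t \<omega> \<partial>Q)"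
      by (rule swap(3)) (use U'[OF u] s u in auto)
  qed
  also have "\<dots> = ennreal (\<Sum>u\<in>U. \<integral>\<omega>. V \<omega> * indicator (H u) \<omega> * Y t \<omega> \<partial>Q)"
  proof (rule sum_ennreal)
    fix u assume u: "u \<in> U"
    show "0 \<le> (\<integral>\<omega>. V \<omega> * indicator (H u) \<omega> * Y t \<omega> \<partial>Q)"
      by (intro integral_nonneg_AE) (use Y_nonneg in eventually_elim, use VH01 st s in auto)
  qed
  also have "(\<Sum>u\<in>U. \<integral>\<omega>. V \<omega> * indicator (H u) \<omega> * Y t \<omega> \<partial>Q)
      = (\<integral>\<omega>. (\<Sum>u\<in>U. V \<omega> * indicator (H u) \<omega> * Y t \<omega>) \<partial>Q)"
  proof (rule Bochner_Integration.integral_sum[symmetric])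
    fix u assume u: "u \<in> U"
    show "integrable Q (\<lambda>\<omega>. V \<omega> * indicator (H u) \<omega> * Y t \<omega>)"
      by (rule swap(2)[where u=u]) (use U'[OF u] s u in auto)
  qed
  also have "\<dots> = (\<integral>\<omega>. V \<omega> * Y t \<omega> \<partial>Q)"
  proof (rule Bochner_Integration.integral_cong[OF refl])
    fix \<omega> assume "\<omega> \<in> space Q"
    then obtain u where u: "u \<in> U" "\<omega> \<in> H u" using cover by auto
    have "(\<Sum>u\<in>U. indicator (H u) \<omega>) = (1::real)"
    proof -
      have "indicator (H v) \<omega> = (if v = u then 1 else 0 :: real)" if "v \<in> U" for v
        using disj u that by (auto simp: disjoint_family_on_def indicator_def)
      then have "(\<Sum>v\<in>U. indicator (H v) \<omega>) = (\<Sum>v\<in>U. if v = u then 1 else 0 :: real)"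
        by (intro sum.cong) auto
      also have "\<dots> = 1" using u U(1) by simp
      finally show ?thesis .
    qed
    moreover have "(\<Sum>u\<in>U. V \<omega> * indicator (H u) \<omega> * Y t \<omega>) = V \<omega> * (\<Sum>u\<in>U. indicator (H u) \<omega>) * Y t \<omega>"
      by (simp add: sum_distrib_left sum_distrib_right)
    ultimately show "(\<Sum>u\<in>U. V \<omega> * indicator (H u) \<omega> * Y t \<omega>) = V \<omega> * Y t \<omega>"
      by simp
  qed
  also have "\<dots> = (\<integral>\<omega>. V \<omega> * Y s \<omega> \<partial>Q)"
    by (rule martingale_swap(3)[OF mart s st V_meas V01, symmetric]) simp
  also have "ennreal \<dots> = (\<integral>\<^sup>+\<omega>. ennreal (V \<omega> * Y s \<omega>) \<partial>Q)"
    by (rule nn_integral_eq_integral[symmetric, OF martingale_swap(1)[OF mart s st V_meas V01]])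
      (simp, use Y_nonneg in eventually_elim, use V01 s in auto)
  also have "\<dots> \<le> (\<integral>\<^sup>+\<omega>. ennreal (Z s \<omega>) * indicator (space Q) \<omega> \<partial>Q)"
  proof (rule nn_integral_mono_AE)
    show "AE \<omega> in Q. ennreal (V \<omega> * Y s \<omega>) \<le> ennreal (Z s \<omega>) * indicator (space Q) \<omega>"
      using AE_space weighted_K_eq[OF s]
    proof eventually_elim
      case (elim \<omega>)
      show ?case
        using elim Y_eq[OF s, of \<omega>]
        by (cases "ennreal s \<le> T \<omega>") (auto simp: V_def mult.commute)
    qed
  qed
  also have "\<dots> = ?R"
    using s by (subst survival_probability) (auto simp flip: F.space_F[of "ennreal s"])
  finally show ?thesis .
qed

end

section \<open>No increase of \<open>\<Lambda>\<close> without a visit to the critical set\<close>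

context multiplicative_survival
begin

text \<open>This is \<open>E[K\<^sub>\<rho> W] \<le> Q(\<tau> > s)\<close>: the localising times are removed by Fatou's lemma, since every path
  eventually satisfies \<open>t \<le> T n\<close>.\<close>

lemma partition_bound:
  assumes s: "0 \<le> s" "s \<le> t" and U: "finite U" "U \<subseteq> {s..t}"
    and H: "\<And>u. u \<in> U \<Longrightarrow> H u \<in> sets (F (ennreal u))"
    and disj: "disjoint_family_on H U" and cover: "(\<Union>u\<in>U. H u) = space Q"
  shows "(\<integral>\<^sup>+\<omega>. (\<Sum>u\<in>U. ennreal (K u \<omega> * weight s \<omega>) * indicator (H u) \<omega>) \<partial>Q)
    \<le> emeasure Q {\<omega>\<in>space Q. ennreal s < \<tau> \<omega>}"
proof -
  obtain T :: "nat \<Rightarrow> 'w \<Rightarrow> ennreal" where T: "\<And>n. stopping_time F (T n)"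
    "AE \<omega> in Q. incseq (\<lambda>n. T n \<omega>) \<and> (SUP n. T n \<omega>) = \<top>"
    "\<And>n. martingale Q F (stopped K (T n))"
    using K_local_martingale unfolding local_martingale_def by blast
  define f where "f \<omega> = (\<Sum>u\<in>U. ennreal (K u \<omega> * weight s \<omega>) * indicator (H u) \<omega>)" for \<omega>
  have f_meas: "f \<in> borel_measurable Q"
    unfolding f_def[abs_def]
  proof (intro borel_measurable_sum borel_measurable_times_ennreal borel_measurable_indicator
      measurable_compose[OF borel_measurable_times measurable_ennreal])
    fix u assume u: "u \<in> U"
    then have "0 \<le> u" using U(2) s(1) by auto
    then show "K u \<in> borel_measurable Q"
      by (intro measurable_F[OF adapted_later[OF K_adapted _ order_refl]])
    show "weight s \<in> borel_measurable Q"
      by (rule measurable_F[OF measurable_weight[OF s(1)]])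
    show "H u \<in> sets Q" using H[OF u] sets_F_le by auto
  qed
  have T_meas: "T n \<in> borel_measurable Q" for n
    by (rule measurable_stopping_time[OF T(1)]) (auto simp: sets_F_le F.space_F)
  have ind_meas: "(indicator {\<omega>. ennreal t \<le> T n \<omega>} :: 'w \<Rightarrow> ennreal) \<in> borel_measurable Q" for n
  proof (rule measurable_cong[THEN iffD1, OF _ borel_measurable_indicator])
    show "{\<omega>\<in>space Q. ennreal t \<le> T n \<omega>} \<in> sets Q"
      using T_meas[of n] by (simp add: borel_measurable_iff_ge)
  qed (auto simp: indicator_def)
  have "(\<integral>\<^sup>+\<omega>. f \<omega> \<partial>Q) \<le> (\<integral>\<^sup>+\<omega>. liminf (\<lambda>n. f \<omega> * indicator {\<omega>. ennreal t \<le> T n \<omega>} \<omega>) \<partial>Q)"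
  proof (rule nn_integral_mono_AE)
    show "AE \<omega> in Q. f \<omega> \<le> liminf (\<lambda>n. f \<omega> * indicator {\<omega>. ennreal t \<le> T n \<omega>} \<omega>)"
      using T(2)
    proof eventually_elim
      case (elim \<omega>)
      have "ennreal t < (SUP n. T n \<omega>)" unfolding conjunct2[OF elim] by (rule ennreal_less_top)
      then obtain n0 where n0: "ennreal t < T n0 \<omega>" unfolding less_SUP_iff by auto
      show ?case
      proof (rule Liminf_bounded, rule eventually_sequentiallyI[of n0])
        fix n assume "n0 \<le> n"
        then have "T n0 \<omega> \<le> T n \<omega>" using elim by (auto dest: incseqD)
        with n0 have "ennreal t \<le> T n \<omega>" by (meson less_le_trans less_imp_le)
        then show "f \<omega> \<le> f \<omega> * indicator {\<omega>. ennreal t \<le> T n \<omega>} \<omega>" by simp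
      qed
    qed
  qed
  also have "\<dots> \<le> liminf (\<lambda>n. \<integral>\<^sup>+\<omega>. f \<omega> * indicator {\<omega>. ennreal t \<le> T n \<omega>} \<omega> \<partial>Q)"
    by (intro nn_integral_liminf borel_measurable_times_ennreal f_meas ind_meas)
  also have "\<dots> \<le> limsup (\<lambda>n. \<integral>\<^sup>+\<omega>. f \<omega> * indicator {\<omega>. ennreal t \<le> T n \<omega>} \<omega> \<partial>Q)"
    by (rule Liminf_le_Limsup) simp
  also have "\<dots> \<le> emeasure Q {\<omega>\<in>space Q. ennreal s < \<tau> \<omega>}"
    unfolding f_def
    by (intro Limsup_bounded always_eventually allI stopped_partition_bound T s U H disj cover)
  finally show ?thesis unfolding f_def .
qed

context
  fixes s t :: real and G :: "real set" and B :: "real \<Rightarrow> 'w set"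
  assumes s: "0 \<le> s" and st: "s < t" and G: "countable G" "G \<subseteq> {s..t}"
    and B: "\<And>u. u \<in> G \<Longrightarrow> B u \<in> sets (F (ennreal u))"
begin

text \<open>The finite sets \<open>grid k\<close> increase to the countable set \<open>G\<close> of observation times.\<close>

definition grid :: "nat \<Rightarrow> real set" where
  "grid k = G \<inter> from_nat_into G ` {..<k}"

text \<open>The event that \<open>u\<close> is the first time of the grid at which \<open>B\<close> occurs. The time \<open>t\<close> stands for the
  absence of a hit before \<open>t\<close>; with this convention the events partition the space.\<close>

definition first_hit :: "nat \<Rightarrow> real \<Rightarrow> 'w set" where
  "first_hit k u = (if u = t then space Q else B u) - (\<Union>v\<in>{v\<in>grid k. v < u}. B v)"

lemma finite_grid: "finite (grid k)" and grid_subset: "grid k \<subseteq> G"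
  by (auto simp: grid_def)

lemma measurable_first_hit:
  assumes "u \<in> insert t (grid k)"
  shows "first_hit k u \<in> sets (F (ennreal u))"
  unfolding first_hit_def
proof (intro sets.Diff sets.finite_UN)
  show "(if u = t then space Q else B u) \<in> sets (F (ennreal u))"
    using assms grid_subset B sets.top[of "F (ennreal u)"] by (auto simp: F.space_F)
  show "finite {v\<in>grid k. v < u}" using finite_grid by simp
  show "B v \<in> sets (F (ennreal u))" if "v \<in> {v\<in>grid k. v < u}" for v
  proof -
    have "v \<in> G" "ennreal v \<le> ennreal u"
      using that grid_subset[of k] by (auto intro: ennreal_leI)
    then show ?thesis using B[of v] F.sets_F_mono[of "ennreal v" "ennreal u"] by auto
  qed
qed

lemma disjoint_first_hit: "disjoint_family_on (first_hit k) (insert t (grid k))"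
proof -
  have "first_hit k u \<inter> first_hit k v = {}" if "u \<in> insert t (grid k)" "v \<in> insert t (grid k)" "u < v" for u v
  proof -
    have "u \<noteq> t" using that grid_subset G(2) by force
    then show ?thesis using that by (auto simp: first_hit_def)
  qed
  then show ?thesis
    unfolding disjoint_family_on_def by (metis Int_commute linorder_neqE)
qed

lemma first_hit_cover:
  assumes "\<omega> \<in> space Q"
  obtains u where "u \<in> insert t (grid k)" "\<omega> \<in> first_hit k u" "\<And>v. v \<in> grid k \<Longrightarrow> \<omega> \<in> B v \<Longrightarrow> u \<le> v"
proof (cases "{v\<in>grid k. \<omega> \<in> B v} = {}")
  case True
  then show thesis using assms that[of t] by (auto simp: first_hit_def)
next
  case False
  define u where "u = Min {v\<in>grid k. \<omega> \<in> B v}"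
  have fin: "finite {v\<in>grid k. \<omega> \<in> B v}" using finite_grid by simp
  have u: "u \<in> grid k" "\<omega> \<in> B u" using Min_in[OF fin False] by (auto simp: u_def)
  have le: "u \<le> v" if "v \<in> grid k" "\<omega> \<in> B v" for v
    using Min_le[OF fin] that by (auto simp: u_def)
  then have "\<omega> \<in> first_hit k u"
    using u assms by (auto simp: first_hit_def not_le[symmetric])
  with u le show thesis using that[of u] by auto
qed

text \<open>With \<open>\<rho>\<close> the first hit on the grid, or \<open>t\<close> if there is none, this is the event \<open>{s < \<tau> \<le> \<rho>}\<close>.\<close>

definition missed :: "nat \<Rightarrow> 'w set" where
  "missed k = {\<omega>\<in>space Q. ennreal s < \<tau> \<omega>} - (\<Union>u\<in>insert t (grid k). {\<omega>\<in>first_hit k u. ennreal u < \<tau> \<omega>})"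

lemma grid_range: "insert t (grid k) \<subseteq> {s..t}"
  using grid_subset G(2) st by auto

lemma measurable_first_hit_survival:
  assumes "u \<in> insert t (grid k)"
  shows "{\<omega>\<in>first_hit k u. ennreal u < \<tau> \<omega>} \<in> sets Q"
proof -
  have H: "first_hit k u \<in> sets Q" using measurable_first_hit[OF assms] sets_F_le by auto
  have "0 \<le> u" using assms grid_range[of k] s by auto
  then have "first_hit k u \<inter> {\<omega>\<in>space Q. ennreal u < \<tau> \<omega>} \<in> sets Q"
    using H survival_event by auto
  also have "first_hit k u \<inter> {\<omega>\<in>space Q. ennreal u < \<tau> \<omega>} = {\<omega>\<in>first_hit k u. ennreal u < \<tau> \<omega>}"
    using sets.sets_into_space[OF H] by auto
  finally show ?thesis .
qed

lemma measurable_missed: "missed k \<in> sets Q"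
  unfolding missed_def
  using finite_grid[of k] measurable_first_hit_survival[of _ k] survival_event[OF s]
  by (intro sets.Diff sets.finite_UN) auto

text \<open>On the event \<open>A\<close> without hits \<open>\<rho> = t\<close>, so the excess \<open>K\<^sub>t W - Z\<^sub>t\<close> on \<open>A\<close> is part of \<open>K\<^sub>\<rho> W - Z\<^sub>\<rho>\<close>,
  whose expectation is at most \<open>Q(\<tau> > s) - Q(\<tau> > \<rho>)\<close>.\<close>

lemma excess_bound:
  "(\<integral>\<^sup>+\<omega>. ennreal (K t \<omega> * weight s \<omega> - Z t \<omega>) * indicator (space Q - (\<Union>u\<in>G. B u)) \<omega> \<partial>Q)
    \<le> emeasure Q (missed k)"
proof -
  define U where "U = insert t (grid k)"
  define A where "A = space Q - (\<Union>u\<in>G. B u)"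
  define D where "D \<omega> = ennreal (K t \<omega> * weight s \<omega> - Z t \<omega>)" for \<omega>
  define S where "S = {\<omega>\<in>space Q. ennreal s < \<tau> \<omega>}"
  define J where "J u = {\<omega>\<in>first_hit k u. ennreal u < \<tau> \<omega>}" for u
  have fin: "finite U" using finite_grid by (simp add: U_def)
  have U_ge: "s \<le> u" "u \<le> t" "0 \<le> u" if "u \<in> U" for u
    using grid_range[of k] that s by (auto simp: U_def)
  have H: "first_hit k u \<in> sets (F (ennreal u))" if "u \<in> U" for u
    using measurable_first_hit that by (simp add: U_def)
  have J: "J u \<in> sets Q" if "u \<in> U" for u
    using measurable_first_hit_survival that by (simp add: U_def J_def)
  have A_sets: "A \<in> sets Q"
    unfolding A_def using G(1) B sets_F_le by (intro sets.Diff sets.countable_UN'') auto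
  have A_sub: "A \<subseteq> first_hit k t"
    using grid_subset by (auto simp: A_def first_hit_def)
  have Zm: "Z u \<in> borel_measurable Q" and Km: "K u \<in> borel_measurable Q" if "0 \<le> u" for u
    using that measurable_F[OF adapted_later[OF Z_adapted that order_refl]]
      measurable_F[OF adapted_later[OF K_adapted that order_refl]] by auto
  have Wm: "weight s \<in> borel_measurable Q" by (rule measurable_F[OF measurable_weight[OF s]])
  have D_meas: "D \<in> borel_measurable Q"
    unfolding D_def[abs_def] using Zm[of t] Km[of t] Wm s st
    by (intro measurable_compose[OF _ measurable_ennreal] borel_measurable_diff borel_measurable_times) auto
  have ZH_meas: "(\<lambda>\<omega>. ennreal (Z u \<omega>) * indicator (first_hit k u) \<omega>) \<in> borel_measurable Q" if "u \<in> U" for u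
    using Zm[OF U_ge(3)[OF that]] H[OF that] sets_F_le
    by (intro borel_measurable_times_ennreal borel_measurable_indicator measurable_compose[OF _ measurable_ennreal]) auto
  have J_eq: "(\<integral>\<^sup>+\<omega>. ennreal (Z u \<omega>) * indicator (first_hit k u) \<omega> \<partial>Q) = emeasure Q (J u)" if "u \<in> U" for u
    unfolding J_def by (rule survival_probability[OF U_ge(3)[OF that] H[OF that]])
  have J_disj: "disjoint_family_on J U"
    using disjoint_first_hit[of k] unfolding disjoint_family_on_def U_def J_def by fast
  have J_sub: "(\<Union>u\<in>U. J u) \<subseteq> S"
  proof clarify
    fix u \<omega> assume u: "u \<in> U" and \<omega>: "\<omega> \<in> J u"
    have "\<omega> \<in> space Q" using \<omega> sets.sets_into_space[OF J[OF u]] by auto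
    moreover have "ennreal s < \<tau> \<omega>"
      using \<omega> ennreal_leI[OF U_ge(1)[OF u]] by (auto simp: J_def)
    ultimately show "\<omega> \<in> S" by (simp add: S_def)
  qed
  have JU: "(\<Union>u\<in>U. J u) \<in> sets Q" using fin J by auto
  have missed_eq: "missed k = S - (\<Union>u\<in>U. J u)"
    by (simp add: missed_def S_def U_def J_def)
  \<comment> \<open>Subtraction of extended nonnegative numbers is truncated, so \<open>Q(\<tau> > \<rho>)\<close> is carried along and
    cancelled at the end.\<close>
  have "emeasure Q (\<Union>u\<in>U. J u) + (\<integral>\<^sup>+\<omega>. D \<omega> * indicator A \<omega> \<partial>Q)
      = (\<Sum>u\<in>U. emeasure Q (J u)) + (\<integral>\<^sup>+\<omega>. D \<omega> * indicator A \<omega> \<partial>Q)"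
    using J by (subst sum_emeasure[OF _ J_disj fin]) auto
  also have "(\<Sum>u\<in>U. emeasure Q (J u)) = (\<integral>\<^sup>+\<omega>. (\<Sum>u\<in>U. ennreal (Z u \<omega>) * indicator (first_hit k u) \<omega>) \<partial>Q)"
    using J_eq ZH_meas by (subst nn_integral_sum) auto
  also have "\<dots> + (\<integral>\<^sup>+\<omega>. D \<omega> * indicator A \<omega> \<partial>Q)
      = (\<integral>\<^sup>+\<omega>. (\<Sum>u\<in>U. ennreal (Z u \<omega>) * indicator (first_hit k u) \<omega>) + D \<omega> * indicator A \<omega> \<partial>Q)"
    by (intro nn_integral_add[symmetric] borel_measurable_sum ZH_meas
        borel_measurable_times_ennreal[OF D_meas borel_measurable_indicator[OF A_sets]])
  also have "\<dots> \<le> (\<integral>\<^sup>+\<omega>. (\<Sum>u\<in>U. ennreal (K u \<omega> * weight s \<omega>) * indicator (first_hit k u) \<omega>) \<partial>Q)"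
  proof (rule nn_integral_mono_AE)
    have "AE \<omega> in Q. \<forall>u\<in>U. 0 < Z u \<omega> \<and> Z u \<omega> \<le> K u \<omega> * weight s \<omega>"
      using Z_pos weighted_K_ge[OF s] U_ge fin by (intro AE_finite_allI) auto
    then show "AE \<omega> in Q. (\<Sum>u\<in>U. ennreal (Z u \<omega>) * indicator (first_hit k u) \<omega>) + D \<omega> * indicator A \<omega>
        \<le> (\<Sum>u\<in>U. ennreal (K u \<omega> * weight s \<omega>) * indicator (first_hit k u) \<omega>)"
    proof eventually_elim
      case (elim \<omega>)
      have tU: "t \<in> U" by (simp add: U_def)
      have t: "0 < Z t \<omega>" "Z t \<omega> \<le> K t \<omega> * weight s \<omega>" using elim tU by auto
      have "ennreal (Z t \<omega>) + D \<omega> = ennreal (K t \<omega> * weight s \<omega>)"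
        unfolding D_def using t by (subst ennreal_plus[symmetric]) auto
      then have at_t: "ennreal (Z t \<omega>) * indicator (first_hit k t) \<omega> + D \<omega> * indicator A \<omega>
          \<le> ennreal (K t \<omega> * weight s \<omega>) * indicator (first_hit k t) \<omega>"
        using A_sub t by (auto simp: indicator_def ennreal_leI)
      have rest: "(\<Sum>u\<in>U - {t}. ennreal (Z u \<omega>) * indicator (first_hit k u) \<omega>)
          \<le> (\<Sum>u\<in>U - {t}. ennreal (K u \<omega> * weight s \<omega>) * indicator (first_hit k u) \<omega>)"
        using elim by (intro sum_mono mult_right_mono ennreal_leI) auto
      show ?case
        unfolding sum.remove[OF fin tU] using add_mono[OF at_t rest] by (simp add: ac_simps)
    qed
  qed
  also have "\<dots> \<le> emeasure Q S"
    unfolding S_def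
  proof (rule partition_bound[where t=t, OF s _ fin])
    show "(\<Union>u\<in>U. first_hit k u) = space Q"
    proof (intro antisym subsetI)
      fix \<omega> assume "\<omega> \<in> (\<Union>u\<in>U. first_hit k u)"
      then obtain u where u: "u \<in> U" "\<omega> \<in> first_hit k u" by blast
      then show "\<omega> \<in> space Q" using sets.sets_into_space[OF H[OF u(1)]] by (auto simp: F.space_F)
    next
      fix \<omega> assume "\<omega> \<in> space Q"
      then obtain u where "u \<in> insert t (grid k)" "\<omega> \<in> first_hit k u"
        using first_hit_cover[of \<omega> k] by blast
      then show "\<omega> \<in> (\<Union>u\<in>U. first_hit k u)" unfolding U_def by blast
    qed
    show "U \<subseteq> {s..t}" unfolding U_def by (rule grid_range)
    show "disjoint_family_on (first_hit k) U" unfolding U_def by (rule disjoint_first_hit)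
  qed (use st H in auto)
  also have "\<dots> = emeasure Q (\<Union>u\<in>U. J u) + emeasure Q (missed k)"
    using J_sub JU survival_event[OF s] unfolding missed_eq
    by (subst plus_emeasure) (auto simp: S_def intro!: arg_cong[where f="emeasure Q"])
  finally show ?thesis
    by (simp add: ennreal_add_left_cancel_le D_def A_def)
qed

text \<open>The hit provided by the hypothesis belongs to all sufficiently fine grids, and then \<open>\<rho>\<close> comes before
  \<open>\<tau>\<close>.\<close>

lemma eventually_not_missed:
  assumes \<omega>: "\<omega> \<in> space Q"
    and hit: "ennreal s < \<tau> \<omega> \<Longrightarrow> \<tau> \<omega> \<le> ennreal t \<Longrightarrow> \<exists>u\<in>G. ennreal u < \<tau> \<omega> \<and> \<omega> \<in> B u"
  shows "eventually (\<lambda>k. \<omega> \<notin> missed k) sequentially"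
proof (cases "ennreal s < \<tau> \<omega>")
  case True
  obtain k0 where k0: "\<And>k u. k \<ge> k0 \<Longrightarrow> u \<in> insert t (grid k) \<Longrightarrow> (\<And>v. v \<in> grid k \<Longrightarrow> \<omega> \<in> B v \<Longrightarrow> u \<le> v) \<Longrightarrow> ennreal u < \<tau> \<omega>"
  proof (cases "\<tau> \<omega> \<le> ennreal t")
    case False
    show thesis
    proof (rule that[of 0])
      fix k u assume "u \<in> insert t (grid k)"
      then have "ennreal u \<le> ennreal t" using grid_range[of k] by (intro ennreal_leI) auto
      with False show "ennreal u < \<tau> \<omega>" by auto
    qed
  next
    case True2: True
    obtain v where v: "v \<in> G" "ennreal v < \<tau> \<omega>" "\<omega> \<in> B v"
      using hit[OF True True2] by auto
    obtain j where j: "from_nat_into G j = v"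
      using subset_range_from_nat_into[OF G(1)] v(1) by auto
    show thesis
    proof (rule that[of "Suc j"])
      fix k u assume k: "Suc j \<le> k" and min: "\<And>v. v \<in> grid k \<Longrightarrow> \<omega> \<in> B v \<Longrightarrow> u \<le> v"
      have "v \<in> grid k" using k j v(1) by (auto simp: grid_def)
      then have "ennreal u \<le> ennreal v" using min v(3) by (intro ennreal_leI) auto
      then show "ennreal u < \<tau> \<omega>" using v(2) by auto
    qed
  qed
  show ?thesis
  proof (rule eventually_sequentiallyI[of k0])
    fix k assume k: "k0 \<le> k"
    obtain u where u: "u \<in> insert t (grid k)" "\<omega> \<in> first_hit k u" "\<And>v. v \<in> grid k \<Longrightarrow> \<omega> \<in> B v \<Longrightarrow> u \<le> v"
      using first_hit_cover[OF \<omega>, of k] by blast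
    then have "ennreal u < \<tau> \<omega>" using k0[OF k] by blast
    with u show "\<omega> \<notin> missed k" by (auto simp: missed_def)
  qed
qed (simp add: missed_def)

text \<open>If every path whose \<open>\<tau>\<close> falls into \<open>(s,t]\<close> is warned by one of the events \<open>B u\<close> before \<open>\<tau>\<close>, then \<open>\<Lambda>\<close>
  cannot increase on \<open>[s,t]\<close> without a warning. The bound for the excess tends to 0 as the grids become
  finer, and a vanishing excess means \<open>exp(\<Lambda>\<^sub>t - \<Lambda>\<^sub>s) Z\<^sub>t \<le> Z\<^sub>t\<close>.\<close>

lemma flat_off_hits:
  assumes hit: "AE \<omega> in Q. ennreal s < \<tau> \<omega> \<longrightarrow> \<tau> \<omega> \<le> ennreal t \<longrightarrow> (\<exists>u\<in>G. ennreal u < \<tau> \<omega> \<and> \<omega> \<in> B u)"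
  shows "AE \<omega> in Q. (\<forall>u\<in>G. \<omega> \<notin> B u) \<longrightarrow> \<Lambda> s \<omega> = \<Lambda> t \<omega>"
proof -
  define A where "A = space Q - (\<Union>u\<in>G. B u)"
  define D where "D \<omega> = ennreal (K t \<omega> * weight s \<omega> - Z t \<omega>)" for \<omega>
  have "(\<lambda>k. \<integral>\<^sup>+\<omega>. indicator (missed k) \<omega> \<partial>Q) \<longlonglongrightarrow> (\<integral>\<^sup>+\<omega>. 0 \<partial>Q)"
  proof (rule nn_integral_dominated_convergence[where w="\<lambda>_. 1"])
    show "indicator (missed k) \<in> borel_measurable Q" for k
      using measurable_missed by simp
    show "AE \<omega> in Q. (\<lambda>k. indicator (missed k) \<omega> :: ennreal) \<longlonglongrightarrow> 0"
      using AE_space hit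
    proof eventually_elim
      case (elim \<omega>)
      have "eventually (\<lambda>k. \<omega> \<notin> missed k) sequentially"
        using elim by (intro eventually_not_missed) auto
      then have "eventually (\<lambda>k. 0 = (indicator (missed k) \<omega> :: ennreal)) sequentially"
        by eventually_elim simp
      then show ?case by (rule Lim_transform_eventually[OF tendsto_const])
    qed
  qed (auto simp: indicator_def emeasure_space_1)
  then have lim: "(\<lambda>k. emeasure Q (missed k)) \<longlonglongrightarrow> 0"
    using measurable_missed by simp
  have "(\<integral>\<^sup>+\<omega>. D \<omega> * indicator A \<omega> \<partial>Q) \<le> 0"
    unfolding D_def A_def
    by (rule tendsto_lowerbound[OF lim]) (intro always_eventually allI excess_bound, simp)
  moreover have "(\<lambda>\<omega>. D \<omega> * indicator A \<omega>) \<in> borel_measurable Q"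
  proof (intro borel_measurable_times_ennreal borel_measurable_indicator)
    show "A \<in> sets Q"
      unfolding A_def using G(1) B sets_F_le by (intro sets.Diff sets.countable_UN'') auto
    show "D \<in> borel_measurable Q"
      unfolding D_def[abs_def]
      using measurable_F[OF adapted_later[OF Z_adapted _ order_refl], of t]
        measurable_F[OF adapted_later[OF K_adapted _ order_refl], of t]
        measurable_F[OF measurable_weight[OF s]] s st
      by (intro measurable_compose[OF _ measurable_ennreal] borel_measurable_diff borel_measurable_times) auto
  qed
  ultimately have "AE \<omega> in Q. D \<omega> * indicator A \<omega> = 0"
    by (simp add: nn_integral_0_iff_AE)
  then show ?thesis
    using AE_space weight_eq[OF s] Z_eq \<Lambda>_mono Z_pos[OF order_trans[OF s less_imp_le[OF st]]]
  proof eventually_elim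
    case (elim \<omega>)
    show ?case
    proof (rule impI)
      assume "\<forall>u\<in>G. \<omega> \<notin> B u"
      then have "\<omega> \<in> A" using elim(2) by (auto simp: A_def)
      then have "D \<omega> = 0" using elim(1) by simp
      then have le: "K t \<omega> * weight s \<omega> \<le> Z t \<omega>" by (simp add: D_def ennreal_eq_0_iff)
      have Zt: "Z t \<omega> = exp (- \<Lambda> t \<omega>) * K t \<omega>" using elim(4) s st by auto
      then have "0 < K t \<omega>" using elim(6) by (simp add: zero_less_mult_iff)
      with le have "exp (- \<Lambda> s \<omega>) \<le> exp (- \<Lambda> t \<omega>)"
        unfolding elim(3) Zt by (simp add: mult.commute)
      then have "\<Lambda> t \<omega> \<le> \<Lambda> s \<omega>" by simp
      moreover have "\<Lambda> s \<omega> \<le> \<Lambda> t \<omega>"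
        using elim(5) s st by (intro mono_onD[of "{0..}" "\<lambda>t. \<Lambda> t \<omega>"]) auto
      ultimately show "\<Lambda> s \<omega> = \<Lambda> t \<omega>" by simp
    qed
  qed
qed

end

end

section \<open>Singularity of a single path\<close>

lemma AE_lborel_witness:
  fixes a b :: real
  assumes "AE t in lborel. R t" "a < b"
  obtains t where "a < t" "t < b" "R t"
proof (rule ccontr)
  assume "\<not> thesis"
  then have "\<not> R t" if "t \<in> {a<..<b}" for t using that \<open>\<And>t. a < t \<Longrightarrow> t < b \<Longrightarrow> R t \<Longrightarrow> thesis\<close> by auto
  then have "AE t in lborel. t \<notin> {a<..<b}"
    using assms(1) by (auto elim: eventually_mono)
  then have "{a<..<b} \<in> null_sets lborel"
    by (subst AE_iff_null_sets) auto
  then show False using \<open>a < b\<close> by (simp add: null_sets_def)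
qed

text \<open>The points have rationals to their right that separate them from all later points.\<close>

lemma countable_right_isolated:
  fixes A :: "real set"
  assumes "\<And>t. t \<in> A \<Longrightarrow> \<exists>b>t. {t<..<b} \<inter> A = {}"
  shows "countable A"
proof -
  obtain b where b: "\<And>t. t \<in> A \<Longrightarrow> t < b t" "\<And>t. t \<in> A \<Longrightarrow> {t<..<b t} \<inter> A = {}"
    using assms by metis
  have "\<forall>t\<in>A. \<exists>q\<in>\<rat>. t < q \<and> q < b t"
    using b(1) Rats_dense_in_real by blast
  then obtain q where q: "\<And>t. t \<in> A \<Longrightarrow> q t \<in> \<rat>" "\<And>t. t \<in> A \<Longrightarrow> t < q t" "\<And>t. t \<in> A \<Longrightarrow> q t < b t"
    by metis
  have lt: "q t < q u" if "t \<in> A" "u \<in> A" "t < u" for t u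
  proof -
    have "b t \<le> u" using b(2)[OF that(1)] that by (auto simp: not_less[symmetric])
    then show ?thesis using q(3)[OF that(1)] q(2)[OF that(2)] by simp
  qed
  have "inj_on q A"
    by (rule inj_onI) (metis lt less_irrefl linorder_neqE)
  moreover have "countable (q ` A)"
    by (rule countable_subset[OF _ countable_rat]) (use q(1) in auto)
  ultimately show ?thesis by (rule countable_image_inj_on[rotated])
qed

text \<open>The intervals with rational ends on which \<open>g\<close> is bounded away from 0 have an open union \<open>U\<close> of
  measure 0 under \<open>df\<close>. Right continuity of \<open>g\<close> makes every positive time outside \<open>U\<close> with \<open>g > 0\<close>
  isolated from the right among such times, so there are only countably many of them.\<close>

lemma mutually_singular_if_flat_where_positive:
  fixes f g :: "real \<Rightarrow> real"
  assumes mono: "mono_on {0..} f" and rc: "\<And>t. 0 \<le> t \<Longrightarrow> (f \<longlongrightarrow> f t) (at_right t)"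
    and g: "\<And>t. 0 \<le> t \<Longrightarrow> (g \<longlongrightarrow> g t) (at_right t)"
    and pos: "AE t in lborel. 0 < t \<longrightarrow> 0 < g t"
    and flat: "\<And>s t n. s \<in> \<rat> \<Longrightarrow> t \<in> \<rat> \<Longrightarrow> 0 \<le> s \<Longrightarrow> s < t \<Longrightarrow>
      \<forall>u\<in>\<rat> \<inter> {s..t}. 1 / real (Suc n) \<le> g u \<Longrightarrow> f s = f t"
  shows "mutually_singular (stieltjes_measure f) lborel"
proof -
  define f0 where "f0 t = f (max 0 t)" for t
  have f0_mono: "f0 x \<le> f0 y" if "x \<le> y" for x y
    unfolding f0_def using that by (intro mono_onD[OF mono]) auto
  have f0_rc: "continuous (at_right a) f0" for a
  proof (cases "a < 0")
    case True
    have "eventually (\<lambda>x. f 0 = f0 x) (at_right a)"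
      unfolding eventually_at_right_field using True by (intro exI[of _ 0]) (auto simp: f0_def)
    then have "(f0 \<longlongrightarrow> f 0) (at_right a)"
      by (rule Lim_transform_eventually[OF tendsto_const])
    then show ?thesis using True by (simp add: continuous_within f0_def)
  next
    case False
    have "eventually (\<lambda>x. f x = f0 x) (at_right a)"
      unfolding eventually_at_right_field using False by (intro exI[of _ "a + 1"]) (auto simp: f0_def)
    then have "(f0 \<longlongrightarrow> f a) (at_right a)"
      using False by (intro Lim_transform_eventually[OF rc]) auto
    then show ?thesis using False by (simp add: continuous_within f0_def)
  qed
  have f0_interval: "emeasure (interval_measure f0) {a<..b} = f0 b - f0 a" if "a \<le> b" for a b
    using that f0_mono f0_rc by (rule emeasure_interval_measure_Ioc)
  define I where "I = {(s, t) \<in> \<rat> \<times> \<rat>. 0 \<le> s \<and> s < t \<and> (\<exists>n. \<forall>u\<in>\<rat> \<inter> {s..t}. 1 / real (Suc n) \<le> g u)}"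
  have "countable I"
    by (rule countable_subset[of _ "\<rat> \<times> \<rat>"]) (auto simp: I_def countable_rat)
  define U where "U = (\<Union>(s, t)\<in>I. {s<..<t})"
  \<comment> \<open>The negative half-line belongs to \<open>S\<close> because \<open>df\<close> was extended by 0 to it.\<close>
  define S where "S = (\<Union>n. {- real n<..0}) - {0} \<union> U"
  have U_null: "U \<in> null_sets (interval_measure f0)"
    unfolding U_def
  proof (rule null_sets_UN'[OF \<open>countable I\<close>], clarify)
    fix s t assume st: "(s, t) \<in> I"
    then obtain n where n: "s \<in> \<rat>" "t \<in> \<rat>" "0 \<le> s" "s < t" "\<forall>u\<in>\<rat> \<inter> {s..t}. 1 / real (Suc n) \<le> g u"
      unfolding I_def by blast
    from flat[OF n] have "f0 s = f0 t" using n by (simp add: f0_def)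
    then have "{s<..t} \<in> null_sets (interval_measure f0)"
      using f0_interval[of s t] n by (simp add: null_sets_def)
    then show "{s<..<t} \<in> null_sets (interval_measure f0)"
      by (rule null_sets_subset) auto
  qed
  have neg_null: "(\<Union>n. {- real n<..0}) \<in> null_sets (interval_measure f0)"
  proof (rule null_sets_UN)
    show "{- real n<..0} \<in> null_sets (interval_measure f0)" for n
      using f0_interval[of "- real n" 0] by (simp add: null_sets_def f0_def)
  qed
  have S_null: "S \<in> null_sets (interval_measure f0)"
    unfolding S_def using neg_null U_null by (intro null_sets.Un) (auto intro: null_sets_subset)
  define C where "C = {t. 0 < t \<and> 0 < g t \<and> t \<notin> U}"
  have "countable C"
  proof (rule countable_right_isolated)
    fix t assume t: "t \<in> C"
    then have "eventually (\<lambda>s. g t / 2 < g s) (at_right t)"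
      by (intro order_tendstoD(1)[OF g]) (auto simp: C_def)
    then obtain b where b: "b > t" "\<And>s. t < s \<Longrightarrow> s < b \<Longrightarrow> g t / 2 < g s"
      by (auto simp: eventually_at_right_field)
    obtain n where n: "1 / real (Suc n) < g t / 2"
      using reals_Archimedean[of "g t / 2"] t by (auto simp: C_def inverse_eq_divide)
    have "y \<in> U" if y: "t < y" "y < b" for y
    proof -
      obtain p where p: "p \<in> \<rat>" "t < p" "p < y" using Rats_dense_in_real[OF y(1)] by auto
      obtain q where q: "q \<in> \<rat>" "y < q" "q < b" using Rats_dense_in_real[OF y(2)] by auto
      have "1 / real (Suc n) \<le> g u" if "u \<in> {p..q}" for u
        using b(2)[of u] n that p q by auto
      then have "\<exists>n. \<forall>u\<in>\<rat> \<inter> {p..q}. 1 / real (Suc n) \<le> g u"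
        by blast
      then have "(p, q) \<in> I"
        using p q t by (simp add: I_def C_def)
      then show ?thesis using p q by (auto simp: U_def intro!: bexI[of _ "(p, q)"])
    qed
    then show "\<exists>b>t. {t<..<b} \<inter> C = {}"
      using b(1) by (intro exI[of _ b]) (auto simp: C_def)
  qed
  then have "AE t in lborel. t \<notin> C"
    by (intro AE_not_in countable_imp_null_set_lborel)
  moreover have "AE t in lborel. (t::real) \<noteq> 0"
    by (rule AE_lborel_singleton)
  ultimately have "AE t in lborel. t \<notin> UNIV - S"
    using pos
  proof eventually_elim
    case (elim t)
    show ?case
    proof (cases "t < 0")
      case True
      obtain n where "- t < real n" using reals_Archimedean2 by blast
      then show ?thesis using True by (auto simp: S_def intro!: exI[of _ n])
    next
      case False
      then show ?thesis using elim by (auto simp: S_def C_def)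
    qed
  qed
  moreover have S_sets: "S \<in> sets borel"
    using null_setsD2[OF S_null] by simp
  ultimately have "UNIV - S \<in> null_sets lborel"
    by (subst AE_iff_null_sets) auto
  then show ?thesis
    unfolding mutually_singular_def stieltjes_measure_def f0_def[symmetric, abs_def]
    using S_null S_sets by (auto simp: null_sets_def intro!: bexI[of _ S])
qed

lemma distributed_avoids_null_set:
  assumes X: "distributed M N X f" and A: "A \<in> null_sets N"
  shows "AE \<omega> in M. X \<omega> \<notin> A"
proof -
  have "A \<in> null_sets (density N f)"
    using absolutely_continuousI_density[of f N] A distributed_borel_measurable[OF X]
    by (auto simp: absolutely_continuous_def)
  then have "A \<in> null_sets (distr M N X)"
    using distributed_distr_eq_density[OF X] by simp
  then have "X -` A \<inter> space M \<in> null_sets M"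
    using distributed_measurable[OF X] by (auto simp: null_sets_def emeasure_distr)
  then have "AE \<omega> in M. \<omega> \<notin> X -` A \<inter> space M"
    by (rule AE_not_in)
  with AE_space show ?thesis
    by eventually_elim auto
qed

lemma sets_lborel_option: "sets lborel_option = sets borel"
  by (simp add: lborel_option_def)

text \<open>Images under \<open>Some\<close> of Borel sets are Borel, since \<open>the\<close> is continuous whatever value it has at
  \<open>None\<close>.\<close>

lemma Some_null_set:
  assumes B: "B \<in> null_sets (lborel :: 'd::euclidean_space measure)"
  shows "Some ` B \<in> null_sets lborel_option"
proof -
  have "continuous_on UNIV (the :: 'd option \<Rightarrow> 'd)"
    by (rule continuous_on_optionI) simp
  then have "(the :: 'd option \<Rightarrow> 'd) \<in> borel_measurable borel"
    by (rule borel_measurable_continuous_onI)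
  then have "the -` B \<inter> space borel \<in> sets (borel :: 'd option measure)"
    using B by (intro measurable_sets) auto
  moreover have "open (range Some :: 'd option set)"
    by (simp add: open_option_def vimage_def)
  ultimately have "(the -` B \<inter> space borel) \<inter> range Some \<in> sets (borel :: 'd option measure)"
    by (intro sets.Int) auto
  also have "(the -` B \<inter> space borel) \<inter> range Some = Some ` B"
    by auto
  finally have *: "Some ` B \<in> sets borel" .
  have "continuous_on UNIV (Some :: 'd \<Rightarrow> 'd option)"
    by (subst continuous_on_open_vimage) (auto simp: open_option_def)
  then have "Some \<in> borel_measurable (lborel :: 'd measure)"
    using borel_measurable_continuous_onI by simp
  then have "emeasure lborel_option (Some ` B) = emeasure lborel (Some -` Some ` B \<inter> space lborel)"
    unfolding lborel_option_def using * by (intro emeasure_distr) auto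
  also have "Some -` Some ` B \<inter> space lborel = B" by auto
  finally show ?thesis using B * by (simp add: null_sets_def sets_lborel_option)
qed

lemma None_null_set: "{None} \<in> null_sets (lborel_option :: 'd::euclidean_space option measure)"
proof -
  have "open {None :: 'd option}"
    by (simp add: open_option_def vimage_def)
  then have *: "{None :: 'd option} \<in> sets borel" by simp
  have "continuous_on UNIV (Some :: 'd \<Rightarrow> 'd option)"
    by (subst continuous_on_open_vimage) (auto simp: open_option_def)
  then have "Some \<in> borel_measurable (lborel :: 'd measure)"
    using borel_measurable_continuous_onI by simp
  then have "emeasure lborel_option {None :: 'd option} = emeasure (lborel :: 'd measure) (Some -` {None} \<inter> space lborel)"
    unfolding lborel_option_def using * by (intro emeasure_distr) auto
  also have "Some -` {None :: 'd option} \<inter> space lborel = {}" by auto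
  finally show ?thesis using * by (simp add: null_sets_def sets_lborel_option)
qed

text \<open>The added point counts as far away from \<open>A\<close>, and so does every point if \<open>A\<close> is empty, where \<open>infdist\<close>
  would be 0. With these values the function is continuous and vanishes exactly on the closure of \<open>A\<close>.\<close>

definition option_dist :: "'d::metric_space set \<Rightarrow> 'd option \<Rightarrow> real" where
  "option_dist A x = (case x of None \<Rightarrow> 1 | Some z \<Rightarrow> if A = {} then 1 else infdist z A)"

lemma continuous_option_dist: "continuous_on UNIV (option_dist A)"
  by (rule continuous_on_optionI, cases "A = {}")
    (auto simp: option_dist_def intro!: continuous_on_infdist continuous_on_const continuous_on_id)

lemma option_dist_pos_iff: "0 < option_dist A x \<longleftrightarrow> x \<notin> Some ` closure A"
proof (cases x)
  case (Some z)
  have "0 < infdist z A \<longleftrightarrow> z \<notin> closure A" if "A \<noteq> {}"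
    using in_closure_iff_infdist_zero[OF that, of z] infdist_nonneg[of z A] by auto
  then show ?thesis using Some by (auto simp: option_dist_def)
qed (auto simp: option_dist_def)

text \<open>A law with a density on \<open>\<real>\<^sup>k\<close> gives no mass to \<open>\<Delta>\<close>, and there are arbitrarily late times with such a
  law. Since \<open>\<Delta>\<close> is absorbing, it is never reached.\<close>

lemma lifetime_infinite_if_densities:
  fixes \<pi> :: "'e::topological_space \<Rightarrow> 'd::euclidean_space"
  assumes "AE t in lborel. 0 < t \<longrightarrow> (\<exists>f. distributed Q lborel_option (observed \<pi> t) f)"
    and "space Q = path_space"
  shows "AE \<omega> in Q. lifetime \<omega> = \<top>"
proof -
  have "\<exists>t. real n < t \<and> (\<exists>f. distributed Q lborel_option (observed \<pi> t) f)" for n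
  proof -
    obtain t where "real n < t" "0 < t \<longrightarrow> (\<exists>f. distributed Q lborel_option (observed \<pi> t) f)"
      by (rule AE_lborel_witness[OF assms(1), of "real n" "real n + 1"]) auto
    then show ?thesis by (intro exI[of _ t]) auto
  qed
  then obtain t where t: "\<And>n. real n < t n" "\<And>n. \<exists>f. distributed Q lborel_option (observed \<pi> (t n)) f"
    by metis
  have "AE \<omega> in Q. observed \<pi> (t n) \<omega> \<notin> {None}" for n
    using t(2)[of n] distributed_avoids_null_set[OF _ None_null_set] by blast
  then have "AE \<omega> in Q. \<forall>n. observed \<pi> (t n) \<omega> \<notin> {None}"
    by (simp add: AE_all_countable)
  with AE_space show ?thesis
  proof eventually_elim
    case (elim \<omega>)
    have "\<omega> r \<noteq> None" if "0 \<le> r" for r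
    proof
      assume "\<omega> r = None"
      obtain n where "r < real n" using reals_Archimedean2 by blast
      then have "r \<le> t n" using t(1)[of n] by simp
      moreover have "\<forall>s\<ge>0. \<omega> s = None \<longrightarrow> (\<forall>t\<ge>s. \<omega> t = None)"
        using elim(1) by (simp add: assms(2) path_space_def)
      ultimately have "\<omega> (t n) = None" using \<open>\<omega> r = None\<close> that by blast
      moreover have "observed \<pi> (t n) \<omega> \<noteq> None" using elim(2) by auto
      ultimately show False by (simp add: observed_def)
    qed
    then show ?case by (simp add: lifetime_top_iff)
  qed
qed

text \<open>The closure is taken in \<open>D\<close>, which need not be a Borel set; but \<open>X\<close> takes its values in \<open>D\<close>, so a Borel
  null set around the closure in \<open>D\<close> catches all visits to the closure in the whole space.\<close>

lemma observed_off_closure: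
  fixes \<pi> :: "'e::topological_space \<Rightarrow> 'd::euclidean_space"
  assumes X: "distributed Q lborel_option (observed \<pi> t) f" and \<pi>: "range \<pi> \<subseteq> D" and A: "A \<subseteq> D"
    and null: "(top_of_set D) closure_of A \<in> null_sets lebesgue"
  shows "AE \<omega> in Q. 0 < option_dist A (observed \<pi> t \<omega>)"
proof -
  obtain B where B: "B \<in> null_sets lborel" "(top_of_set D) closure_of A \<subseteq> B"
    using null null_sets_completion_iff2[of _ lborel] by auto
  have "D \<inter> closure A \<subseteq> B"
    using B(2) A by (simp add: closure_of_subtopology Int_absorb1)
  show ?thesis
    using distributed_avoids_null_set[OF X Some_null_set[OF B(1)]]
  proof eventually_elim
    case (elim \<omega>)
    have "observed \<pi> t \<omega> \<notin> Some ` closure A"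
    proof
      assume "observed \<pi> t \<omega> \<in> Some ` closure A"
      then obtain z where z: "observed \<pi> t \<omega> = Some z" "z \<in> closure A" by auto
      then have "z \<in> D" using \<pi> by (auto simp: observed_def)
      with z elim \<open>D \<inter> closure A \<subseteq> B\<close> show False by auto
    qed
    then show ?case by (simp add: option_dist_pos_iff)
  qed
qed

text \<open>For almost every fixed time almost every path is off the closure; Fubini interchanges the two.\<close>

lemma observed_off_closure_at_almost_every_time:
  fixes \<pi> :: "'e::second_countable_topology \<Rightarrow> 'd::euclidean_space"
  assumes Q: "prob_space Q" "space Q = path_space" "\<And>t. sets (G_filtration t) \<subseteq> sets Q"
    and densities: "AE t in lborel. 0 < t \<longrightarrow> (\<exists>f. distributed Q lborel_option (observed \<pi> t) f)"
    and \<pi>: "continuous_on UNIV \<pi>" "range \<pi> \<subseteq> D" and A: "A \<subseteq> D"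
    and null: "(top_of_set D) closure_of A \<in> null_sets lebesgue"
  shows "AE \<omega> in Q. AE t in lborel. 0 < t \<longrightarrow> 0 < option_dist A (observed \<pi> t \<omega>)"
proof -
  interpret prob_space Q by fact
  interpret pair_sigma_finite lborel Q
    by (intro pair_sigma_finite.intro lborel.sigma_finite_measure_axioms sigma_finite_measure_axioms)
  define g where "g x = option_dist A (map_option \<pi> x)" for x
  have g: "continuous_on UNIV g"
    unfolding g_def[abs_def]
    by (rule continuous_on_compose2[OF continuous_option_dist continuous_on_map_option[OF \<pi>(1)]]) simp
  have g_obs: "option_dist A (observed \<pi> t \<omega>) = g (\<omega> t)" for t \<omega>
    by (simp add: g_def observed_def)
  have coord: "(\<lambda>\<omega>. g (\<omega> u)) \<in> borel_measurable Q" if "0 \<le> u" for u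
  proof -
    have "(\<lambda>\<omega>. g (\<omega> u)) \<in> borel_measurable (G_filtration (ennreal u))"
      by (rule measurable_compose[OF measurable_coordinate[OF that order_refl] borel_measurable_continuous_onI[OF g]])
    then show ?thesis
      using Q(3)[of "ennreal u"] by (auto simp: measurable_def Q(2) filtration.space_F[OF filtration_G])
  qed
  have "(\<lambda>z. g ((snd z) (max 0 (fst z)))) \<in> borel_measurable (lborel \<Otimes>\<^sub>M Q)"
  proof (rule measurable_right_continuous_sample[where t=\<top> and X="\<lambda>u z. g ((snd z) u)" and R="\<lambda>z. max 0 (fst z)"])
    show "(\<lambda>z. g (snd z u)) \<in> borel_measurable (lborel \<Otimes>\<^sub>M Q)" if "0 \<le> u" for u
      by (rule measurable_compose[OF measurable_snd coord[OF that]])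
    show "((\<lambda>s. g (snd z s)) \<longlongrightarrow> g (snd z u)) (at_right u)" if "z \<in> space (lborel \<Otimes>\<^sub>M Q)" "0 \<le> u" for z u
      using that by (intro path_right_continuous g) (auto simp: space_pair_measure Q(2))
    have "fst \<in> borel_measurable ((lborel :: real measure) \<Otimes>\<^sub>M Q)"
      using measurable_fst[of "lborel :: real measure" Q] by (simp only: measurable_cong_sets[OF refl sets_lborel])
    then show "(\<lambda>z. max 0 (fst z) :: real) \<in> borel_measurable (lborel \<Otimes>\<^sub>M Q)"
      by (rule measurable_compose[where g="\<lambda>x. max 0 x"]) measurable
  qed auto
  then have "{z\<in>space (lborel \<Otimes>\<^sub>M Q). 0 < fst z \<longrightarrow> 0 < g ((snd z) (max 0 (fst z)))} \<in> sets (lborel \<Otimes>\<^sub>M Q)"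
    by measurable
  then have "(AE t in lborel. AE \<omega> in Q. 0 < t \<longrightarrow> 0 < g (\<omega> (max 0 t)))
      \<longleftrightarrow> (AE \<omega> in Q. AE t in lborel. 0 < t \<longrightarrow> 0 < g (\<omega> (max 0 t)))"
    by (rule AE_commute)
  moreover have "AE t in lborel. AE \<omega> in Q. 0 < t \<longrightarrow> 0 < g (\<omega> (max 0 t))"
    using densities
  proof eventually_elim
    case (elim t)
    show ?case
    proof (cases "0 < t")
      case True
      then obtain f where "distributed Q lborel_option (observed \<pi> t) f" using elim by auto
      from observed_off_closure[OF this \<pi>(2) A null] show ?thesis
        by eventually_elim (use True in \<open>simp add: g_obs\<close>)
    qed simp
  qed
  ultimately have "AE \<omega> in Q. AE t in lborel. 0 < t \<longrightarrow> 0 < g (\<omega> (max 0 t))"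
    by simp
  then show ?thesis
  proof eventually_elim
    case (elim \<omega>)
    then show ?case by eventually_elim (auto simp: g_obs)
  qed
qed

section \<open>Singularity of \<open>\<Lambda>\<close>\<close>

theorem corollary2:
  fixes h :: "'e::second_countable_topology option \<Rightarrow> real"
    and \<pi> :: "'e \<Rightarrow> 'd::euclidean_space"
    and D :: "'d set"
    and P Q :: "'e path measure"
    and Z \<Lambda> K :: "real \<Rightarrow> 'e path \<Rightarrow> real"
  assumes "locally_compact_space (euclidean :: 'e topology)"
    and "prob_space P" and "sets P = sets G_total"
    and "\<And>y. 0 \<le> h y" and "continuous_on (range Some) h"
    and "AE \<omega> in P. h (\<omega> 0) = 1"
    and "local_martingale P G_filtration (N_process h)"
    and "AE \<omega> in P. \<forall>t\<ge>0. 0 < N_process h t \<omega>"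
    and "continuous_on UNIV \<pi>" and "range \<pi> \<subseteq> D"
    and "equivalent_measure_extension P h \<pi> Q"
    and "survival_process h \<pi> Q Z"
    and "multiplicative_decomposition Q (F_filtration \<pi>) Z \<Lambda> K"
    and "AE t in lborel. 0 < t \<longrightarrow> (\<exists>f. distributed Q lborel_option (observed \<pi> t) f)"
    and "(top_of_set D) closure_of {x \<in> D. \<exists>y. x = \<pi> y \<and> h (Some y) = 0} \<in> null_sets lebesgue"
  shows "AE \<omega> in Q. mutually_singular (stieltjes_measure (\<lambda>t. \<Lambda> t \<omega>)) lborel"
proof -
  note \<pi> = assms(9) and \<pi>_D = assms(10) and extension = assms(11)
    and survival = assms(12) and decomposition = assms(13) and densities = assms(14)
  define D0 where "D0 = {x \<in> D. \<exists>y. x = \<pi> y \<and> h (Some y) = 0}"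
  have D0_null: "(top_of_set D) closure_of D0 \<in> null_sets lebesgue" and D0_sub: "D0 \<subseteq> D"
    using assms(15) by (auto simp: D0_def)
  have "continuous_on UNIV (Some :: 'e \<Rightarrow> 'e option)"
    by (subst continuous_on_open_vimage) (auto simp: open_option_def)
  then have "continuous_on UNIV (\<lambda>x. h (Some x))"
    by (rule continuous_on_compose2[OF assms(5)]) auto
  then have h: "continuous_on UNIV h"
    by (rule continuous_on_optionI)
  obtain T Q0 where T: "tau_versions P h T" "foellmer_measure P h T Q0"
    "\<And>A. A \<in> sets (G_tau_minus T) \<Longrightarrow> emeasure Q A = emeasure Q0 A"
    using extension unfolding equivalent_measure_extension_def by blast
  have Q: "prob_space Q" "sets Q = sets G_total"
    using extension by (auto simp: equivalent_measure_extension_def)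
  have stopping: "stopping_time G_filtration (T n)" if "n \<ge> 1" for n
    using T(1) that by (auto simp: tau_versions_def)
  interpret foellmer_extension h P Q T
  proof (rule foellmer_extension.intro)
    fix n and A :: "'e path set"
    assume n: "n \<ge> 1" and A: "A \<in> sets (strict_pre_sigma path_space G_filtration (T n))"
    have "A \<in> sets (G_stopped (T n))"
      using strict_pre_sigma_le_stopped[OF stopping[OF n]] A by auto
    moreover have "(\<Union>n\<in>{1..}. sets (G_stopped (T n))) \<subseteq> Pow (path_space :: 'e path set)"
    proof (rule UN_least)
      show "sets (G_stopped (T n)) \<subseteq> Pow path_space" for n
        using sets.space_closed[of "G_stopped (T n)"] by (simp add: G_stopped_def G.space_pre_sigma)
    qed
    ultimately have "A \<in> sets (G_tau_minus T)"
      unfolding G_tau_minus_def using n by (subst sets_measure_of) (auto intro!: sigma_sets.Basic)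
    then show "emeasure Q A = emeasure (Q_local P h (T n)) A"
      using T(2,3) n A by (simp add: foellmer_measure_def)
  qed (rule assms(3,4,8) h T(1) Q)+

  have F_le: "sets (F_filtration \<pi> t) \<subseteq> sets Q" for t
    using F_filtration_le_G_filtration[OF \<pi>, of t] sets_G_le(2)[of t] by auto
  interpret F: filtration "space Q" "F_filtration \<pi>"
    unfolding space_Q by (rule filtration_F)
  interpret survival Q "F_filtration \<pi>" "tau h" Z
  proof (intro survival.intro survival_axioms.intro)
    show "prob_space Q" by (rule Q(1))
    show "filtration (space Q) (F_filtration \<pi>)" by unfold_locales
    show "{\<omega> \<in> space Q. ennreal t < tau h \<omega>} \<in> sets Q" if "0 \<le> t" for t
      using measurable_tau_gt[OF h that order_refl] sets_G_le(2) by (auto simp: space_Q)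
  qed (use survival F_le in \<open>auto simp: survival_process_def\<close>)

  \<comment> \<open>The event \<open>Z\<^sub>t \<le> 0\<close> has no mass before \<open>\<tau>\<close>, so it is null under \<open>P\<close>, and then under \<open>Q\<close> because
    the two measures are equivalent on events of \<open>X\<close> up to \<open>t\<close>.\<close>
  have Z_pos: "AE \<omega> in Q. 0 < Z t \<omega>" if t: "0 \<le> t" for t
  proof -
    define B where "B = {\<omega>\<in>space Q. Z t \<omega> \<le> 0}"
    have "Z t \<in> borel_measurable (F_filtration \<pi> (ennreal t))"
      using adapted_later[OF Z_adapted t order_refl] .
    then have B: "B \<in> sets (F_filtration \<pi> (ennreal t))"
      unfolding B_def borel_measurable_iff_le F.space_F by blast
    have "emeasure Q {\<omega>\<in>B. ennreal t < tau h \<omega>} = (\<integral>\<^sup>+\<omega>. 0 \<partial>Q)"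
      unfolding survival_probability[OF t B, symmetric]
      by (intro nn_integral_cong) (auto simp: B_def indicator_def ennreal_neg)
    moreover have "{\<omega>\<in>B. ennreal t < tau h \<omega>} \<in> sets Q"
    proof -
      have "B \<inter> {\<omega>\<in>space Q. ennreal t < tau h \<omega>} \<in> sets Q"
        using B F_le survival_event[OF t] by auto
      also have "B \<inter> {\<omega>\<in>space Q. ennreal t < tau h \<omega>} = {\<omega>\<in>B. ennreal t < tau h \<omega>}"
        by (auto simp: B_def)
      finally show ?thesis .
    qed
    ultimately have "AE \<omega> in Q. \<omega> \<notin> {\<omega>\<in>B. ennreal t < tau h \<omega>}"
      by (intro AE_not_in) auto
    then have "AE \<omega> in Q. ennreal t < tau h \<omega> \<longrightarrow> \<omega> \<notin> B"
      by eventually_elim auto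
    moreover have "B \<in> sets (G_filtration (ennreal t))"
      using B F_filtration_le_G_filtration[OF \<pi>] by auto
    ultimately have "AE \<omega> in P. \<omega> \<notin> B"
      by (intro null_before_tau_imp_null_P[OF t])
    moreover have "B \<in> sets P"
      using B F_le by (auto simp: sets_P sets_Q)
    ultimately have "B \<in> null_sets P"
      by (simp add: AE_iff_null_sets)
    moreover have sub: "subalgebra P (F_filtration \<pi> (ennreal t))" "subalgebra Q (F_filtration \<pi> (ennreal t))"
      using F_le by (auto simp: subalgebra_def F.space_F space_P space_Q sets_P sets_Q)
    moreover have "absolutely_continuous (restr_to_subalg P (F_filtration \<pi> (ennreal t)))
          (restr_to_subalg Q (F_filtration \<pi> (ennreal t)))"
      using extension t by (simp add: equivalent_measure_extension_def)
    ultimately have "B \<in> null_sets Q"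
      using B by (auto simp: absolutely_continuous_def null_sets_restr_to_subalg)
    then have "AE \<omega> in Q. \<omega> \<notin> B" by (rule AE_not_in)
    with AE_space show ?thesis
      by eventually_elim (auto simp: B_def)
  qed

  interpret multiplicative_survival Q "F_filtration \<pi>" "tau h" Z \<Lambda> K
  proof
    show "AE \<omega> in Q. \<Lambda> 0 \<omega> = 0 \<and> mono_on {0..} (\<lambda>t. \<Lambda> t \<omega>)"
      using decomposition unfolding multiplicative_decomposition_def by (auto elim: eventually_mono)
  qed (use decomposition Z_pos in \<open>auto simp: multiplicative_decomposition_def\<close>)

  define g where "g x = option_dist D0 (map_option \<pi> x)" for x
  have g_cont: "continuous_on UNIV g"
    unfolding g_def[abs_def]
    by (rule continuous_on_compose2[OF continuous_option_dist continuous_on_map_option[OF \<pi>]]) simp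
  have g_zero: "g (Some y) = 0" if "h (Some y) = 0" for y
  proof -
    have "\<pi> y \<in> D0" using that \<pi>_D by (auto simp: D0_def)
    then show ?thesis by (auto simp: g_def option_dist_def)
  qed
  \<comment> \<open>A path is warned when \<open>X\<close> comes close to \<open>D\<^sub>0\<close> at a rational time.\<close>
  have flat: "AE \<omega> in Q. (\<forall>u\<in>\<rat> \<inter> {s..t}. 1 / real (Suc n) \<le> g (\<omega> u)) \<longrightarrow> \<Lambda> s \<omega> = \<Lambda> t \<omega>"
    if st: "s \<in> \<rat>" "t \<in> \<rat>" "0 \<le> s" "s < t" for s t n
  proof -
    define B where "B u = {\<omega>\<in>space Q. g (\<omega> u) < 1 / real (Suc n)}" for u
    have "AE \<omega> in Q. (\<forall>u\<in>\<rat> \<inter> {s..t}. \<omega> \<notin> B u) \<longrightarrow> \<Lambda> s \<omega> = \<Lambda> t \<omega>"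
    proof (rule flat_off_hits)
      show "countable (\<rat> \<inter> {s..t})" by (intro countable_Int1 countable_rat)
      show "B u \<in> sets (F_filtration \<pi> (ennreal u))" if "u \<in> \<rat> \<inter> {s..t}" for u
      proof -
        have "(\<lambda>\<omega>. option_dist D0 (observed \<pi> u \<omega>)) \<in> borel_measurable (F_filtration \<pi> (ennreal u))"
          using that st by (intro measurable_compose[OF measurable_observed
                borel_measurable_continuous_onI[OF continuous_option_dist]]) auto
        then show ?thesis
          unfolding borel_measurable_iff_less B_def F.space_F g_def observed_def by blast
      qed
      show "AE \<omega> in Q. ennreal s < tau h \<omega> \<longrightarrow> tau h \<omega> \<le> ennreal t \<longrightarrow>
          (\<exists>u\<in>\<rat> \<inter> {s..t}. ennreal u < tau h \<omega> \<and> \<omega> \<in> B u)"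
        using AE_space witness_before_tau lifetime_infinite_if_densities[OF densities space_Q]
      proof eventually_elim
        case (elim \<omega>)
        show ?case
        proof (intro impI)
          assume \<tau>: "ennreal s < tau h \<omega>" "tau h \<omega> \<le> ennreal t"
          have "\<omega> \<in> path_space" using elim(1) by (simp add: space_Q)
          from close_before_tau[OF this elim(3,2) g_cont g_zero _ st(3) \<tau>, of "1 / real (Suc n)"]
          obtain u where u: "u \<in> \<rat>" "s \<le> u" "ennreal u < tau h \<omega>" "g (\<omega> u) < 1 / real (Suc n)"
            by auto
          have "ennreal u < ennreal t" using u(3) \<tau>(2) by (rule less_le_trans)
          then have "u \<le> t" using u(2) st(3) by (simp add: ennreal_less_iff)
          then show "\<exists>u\<in>\<rat> \<inter> {s..t}. ennreal u < tau h \<omega> \<and> \<omega> \<in> B u"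
            using u elim(1) by (intro bexI[of _ u]) (auto simp: B_def)
        qed
      qed
    qed (use st in auto)
    with AE_space show ?thesis
      by eventually_elim (auto simp: B_def not_less[symmetric])
  qed
  have "AE \<omega> in Q. \<forall>p\<in>{(s, t, n). s \<in> \<rat> \<and> t \<in> \<rat> \<and> 0 \<le> s \<and> s < t} . case p of (s, t, n) \<Rightarrow>
      (\<forall>u\<in>\<rat> \<inter> {s..t}. 1 / real (Suc n) \<le> g (\<omega> u)) \<longrightarrow> \<Lambda> s \<omega> = \<Lambda> t \<omega>"
  proof (subst AE_ball_countable)
    show "countable {(s :: real, t :: real, n :: nat). s \<in> \<rat> \<and> t \<in> \<rat> \<and> 0 \<le> s \<and> s < t}"
      by (rule countable_subset[of _ "\<rat> \<times> \<rat> \<times> UNIV"]) (auto simp: countable_rat)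
  qed (use flat in auto)
  moreover have "AE \<omega> in Q. mono_on {0..} (\<lambda>t. \<Lambda> t \<omega>) \<and> (\<forall>t\<ge>0. ((\<lambda>s. \<Lambda> s \<omega>) \<longlongrightarrow> \<Lambda> t \<omega>) (at_right t))"
    using decomposition unfolding multiplicative_decomposition_def by (auto elim: eventually_mono)
  moreover have "AE \<omega> in Q. AE t in lborel. 0 < t \<longrightarrow> 0 < option_dist D0 (observed \<pi> t \<omega>)"
    by (rule observed_off_closure_at_almost_every_time[OF Q(1) space_Q sets_G_le(2) densities \<pi> \<pi>_D D0_sub D0_null])
  ultimately show ?thesis
    using AE_space
  proof eventually_elim
    case (elim \<omega>)
    show ?case
    proof (rule mutually_singular_if_flat_where_positive[where g="\<lambda>t. g (\<omega> t)"])
      show "((\<lambda>t. g (\<omega> t)) \<longlongrightarrow> g (\<omega> t)) (at_right t)" if "0 \<le> t" for t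
        using that elim(4) by (intro path_right_continuous[OF g_cont]) (auto simp: space_Q)
      show "AE t in lborel. 0 < t \<longrightarrow> 0 < g (\<omega> t)"
        using elim(3) by (simp add: g_def observed_def)
      show "\<Lambda> s \<omega> = \<Lambda> t \<omega>"
        if "s \<in> \<rat>" "t \<in> \<rat>" "0 \<le> s" "s < t" "\<forall>u\<in>\<rat> \<inter> {s..t}. 1 / real (Suc n) \<le> g (\<omega> u)" for s t n
        using bspec[OF elim(1), of "(s, t, n)"] that by auto
    qed (use elim(2) in auto)
  qed
qed

end
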